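(* Let $A$ be a Vidinli algebra over a field $\mathbb{F}$ of characteristic not $2$, and let $B$ be its bilinear form. Then the following assertions hold: (a) The radical of $B$, defined as $\operatorname{rad}B=\{x\in A\mid B(x,A)=0=B(A,x)\}$, is an ideal of $A$ that satisfies $(\operatorname{rad}B)^2=0$. (b) $\operatorname{rad}B$ is the largest solvable ideal of $A$, and either $A/\operatorname{rad}B$ is simple, or $A/\operatorname{rad}B$ is isomorphic to $\mathbb{F}\times\mathbb{F}$. (c) There is a unital subalgebra $S$ of $A$ such that $A=S\oplus\operatorname{rad}B$ (direct sum of subspaces).
   Context: Algebras are not necessarily associative: an algebra over a field $\mathbb{F}$ is a vector space with a bilinear multiplication (of arbitrary dimension). Write $[x,y]=xy-yx$. For a quadratic form $q$, its polar form is denoted by the same letter: $q(x,y)=q(x+y)-q(x)-q(y)$. A conic algebra is a unital algebra $A$ (unity $1$) endowed with a quadratic form $q\colon A\to\mathbb{F}$, called the norm, such that $q(1)=1$ and $x^2-q(x,1)x+q(x)1=0$ for all $x\in A$. A Vidinli algebra is a conic algebra $A$ such that $[A,A]\subseteq\mathbb{F}1$. For a Vidinli algebra $A$ with norm $q$ over a field of characteristic not $2$, let $\omega\colon A\times A\to\mathbb{F}$ be the skew-symmetric bilinear form with $[x,y]=\omega(x,y)1$. The bilinear form of the Vidinli algebra is $B\colon A\times A\to\mathbb{F}$, $B(x,y)=\frac12\bigl(q(x,y)-\omega(x,y)\bigr)$. Ideal means two-sided ideal. An ideal $I$ is solvable if the series $I^{(0)}=I$, $I^{(n+1)}=I^{(n)}I^{(n)}$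 (linear span of products) reaches $0$. An algebra is simple if its multiplication is nonzero and it has no ideals other than $0$ and itself. *)

theory Defs
  imports "HOL-Algebra.Algebra"
begin

section \<open>Not necessarily associative algebras\<close>

text \<open>
  The record type of \<^locale>\<open>module\<close> already carries a multiplication and a unity, on which
  that locale imposes nothing. For non-unital algebras the field \<open>one\<close> is meaningless.
\<close>

locale nonassoc_algebra = module F A + F?: field F
  for F :: "('f, 'm) ring_scheme" and A :: "('f, 'a, 'n) module_scheme" (structure) +
  assumes alg_mult_closed:
      "\<lbrakk>x \<in> carrier A; y \<in> carrier A\<rbrakk> \<Longrightarrow> x \<otimes>\<^bsub>A\<^esub> y \<in> carrier A"
    and alg_l_distr:
      "\<lbrakk>x \<in> carrier A; y \<in> carrier A; z \<in> carrier A\<rbrakk> \<Longrightarrow>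
        (x \<oplus>\<^bsub>A\<^esub> y) \<otimes>\<^bsub>A\<^esub> z = x \<otimes>\<^bsub>A\<^esub> z \<oplus>\<^bsub>A\<^esub> y \<otimes>\<^bsub>A\<^esub> z"
    and alg_r_distr:
      "\<lbrakk>x \<in> carrier A; y \<in> carrier A; z \<in> carrier A\<rbrakk> \<Longrightarrow>
        z \<otimes>\<^bsub>A\<^esub> (x \<oplus>\<^bsub>A\<^esub> y) = z \<otimes>\<^bsub>A\<^esub> x \<oplus>\<^bsub>A\<^esub> z \<otimes>\<^bsub>A\<^esub> y"
    and alg_smult_l:
      "\<lbrakk>c \<in> carrier F; x \<in> carrier A; y \<in> carrier A\<rbrakk> \<Longrightarrow>
        (c \<odot>\<^bsub>A\<^esub> x) \<otimes>\<^bsub>A\<^esub> y = c \<odot>\<^bsub>A\<^esub> (x \<otimes>\<^bsub>A\<^esub> y)"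
    and alg_smult_r:
      "\<lbrakk>c \<in> carrier F; x \<in> carrier A; y \<in> carrier A\<rbrakk> \<Longrightarrow>
        x \<otimes>\<^bsub>A\<^esub> (c \<odot>\<^bsub>A\<^esub> y) = c \<odot>\<^bsub>A\<^esub> (x \<otimes>\<^bsub>A\<^esub> y)"

definition alg_ideal ::
  "('f, 'm) ring_scheme \<Rightarrow> ('f, 'a, 'n) module_scheme \<Rightarrow> 'a set \<Rightarrow> bool" where
  "alg_ideal F A I \<longleftrightarrow> submodule I F A \<and>
     (\<forall>x \<in> carrier A. \<forall>y \<in> I. x \<otimes>\<^bsub>A\<^esub> y \<in> I \<and> y \<otimes>\<^bsub>A\<^esub> x \<in> I)"

definition unital_subalgebra ::
  "('f, 'm) ring_scheme \<Rightarrow> ('f, 'a, 'n) module_scheme \<Rightarrow> 'a set \<Rightarrow> bool" where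
  "unital_subalgebra F A S \<longleftrightarrow> submodule S F A \<and> \<one>\<^bsub>A\<^esub> \<in> S \<and>
     (\<forall>x \<in> S. \<forall>y \<in> S. x \<otimes>\<^bsub>A\<^esub> y \<in> S)"

definition lin_span ::
  "('f, 'm) ring_scheme \<Rightarrow> ('f, 'a, 'n) module_scheme \<Rightarrow> 'a set \<Rightarrow> 'a set" where
  "lin_span F A U = (\<lambda>V. submodule V F A) hull U"

definition span_prod ::
  "('f, 'm) ring_scheme \<Rightarrow> ('f, 'a, 'n) module_scheme \<Rightarrow> 'a set \<Rightarrow> 'a set \<Rightarrow> 'a set" where
  "span_prod F A U V = lin_span F A {u \<otimes>\<^bsub>A\<^esub> v | u v. u \<in> U \<and> v \<in> V}"

definition commutator :: "('f, 'a, 'n) module_scheme \<Rightarrow> 'a \<Rightarrow> 'a \<Rightarrow> 'a" where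
  "commutator A x y = x \<otimes>\<^bsub>A\<^esub> y \<ominus>\<^bsub>A\<^esub> y \<otimes>\<^bsub>A\<^esub> x"

definition span_commutator ::
  "('f, 'm) ring_scheme \<Rightarrow> ('f, 'a, 'n) module_scheme \<Rightarrow> 'a set \<Rightarrow> 'a set \<Rightarrow> 'a set" where
  "span_commutator F A U V = lin_span F A {commutator A u v | u v. u \<in> U \<and> v \<in> V}"

primrec derived_series ::
  "('f, 'm) ring_scheme \<Rightarrow> ('f, 'a, 'n) module_scheme \<Rightarrow> 'a set \<Rightarrow> nat \<Rightarrow> 'a set" where
  "derived_series F A I 0 = I"
| "derived_series F A I (Suc n) =
     span_prod F A (derived_series F A I n) (derived_series F A I n)"

definition solvable_ideal ::
  "('f, 'm) ring_scheme \<Rightarrow> ('f, 'a, 'n) module_scheme \<Rightarrow> 'a set \<Rightarrow> bool" where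
  "solvable_ideal F A I \<longleftrightarrow> alg_ideal F A I \<and> (\<exists>n. derived_series F A I n = {\<zero>\<^bsub>A\<^esub>})"

definition simple_algebra ::
  "('f, 'm) ring_scheme \<Rightarrow> ('f, 'a, 'n) module_scheme \<Rightarrow> bool" where
  "simple_algebra F A \<longleftrightarrow> nonassoc_algebra F A \<and>
     (\<exists>x \<in> carrier A. \<exists>y \<in> carrier A. x \<otimes>\<^bsub>A\<^esub> y \<noteq> \<zero>\<^bsub>A\<^esub>) \<and>
     (\<forall>I. alg_ideal F A I \<longrightarrow> I = {\<zero>\<^bsub>A\<^esub>} \<or> I = carrier A)"

text \<open>
  The quotient ring construction \<^const>\<open>FactRing\<close> makes sense without associativity; it is
  extended by the scalar multiplication induced on cosets.
\<close>

definition quot_algebra ::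
  "('f, 'a, 'n) module_scheme \<Rightarrow> 'a set \<Rightarrow> ('f, 'a set) module" where
  "quot_algebra A I = ring.extend (A Quot I)
     \<lparr>smult = (\<lambda>c K. \<Union>x \<in> K. I +>\<^bsub>A\<^esub> (c \<odot>\<^bsub>A\<^esub> x))\<rparr>"

definition square_algebra :: "('f, 'm) ring_scheme \<Rightarrow> ('f, 'f \<times> 'f) module" where
  "square_algebra F = ring.extend (RDirProd F F)
     \<lparr>smult = (\<lambda>c (a, b). (c \<otimes>\<^bsub>F\<^esub> a, c \<otimes>\<^bsub>F\<^esub> b))\<rparr>"

text \<open>Isomorphism of unital algebras: \<^const>\<open>ring_iso\<close> includes preservation of the unity.\<close>

definition alg_isomorphic ::
  "('f, 'm) ring_scheme \<Rightarrow> ('f, 'a, 'n) module_scheme \<Rightarrow> ('f, 'b, 'k) module_scheme \<Rightarrow> bool" where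
  "alg_isomorphic F A C \<longleftrightarrow>
     (\<exists>h \<in> ring_iso A C. \<forall>c \<in> carrier F. \<forall>x \<in> carrier A. h (c \<odot>\<^bsub>A\<^esub> x) = c \<odot>\<^bsub>C\<^esub> h x)"


section \<open>Quadratic forms\<close>

definition bilinear_form ::
  "('f, 'm) ring_scheme \<Rightarrow> ('f, 'a, 'n) module_scheme \<Rightarrow> ('a \<Rightarrow> 'a \<Rightarrow> 'f) \<Rightarrow> bool" where
  "bilinear_form F A b \<longleftrightarrow>
     (\<forall>x \<in> carrier A. \<forall>y \<in> carrier A. b x y \<in> carrier F) \<and>
     (\<forall>x \<in> carrier A. \<forall>y \<in> carrier A. \<forall>z \<in> carrier A.
        b (x \<oplus>\<^bsub>A\<^esub> y) z = b x z \<oplus>\<^bsub>F\<^esub> b y z \<and> b z (x \<oplus>\<^bsub>A\<^esub> y) = b z x \<oplus>\<^bsub>F\<^esub> b z y) \<and>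
     (\<forall>c \<in> carrier F. \<forall>x \<in> carrier A. \<forall>y \<in> carrier A.
        b (c \<odot>\<^bsub>A\<^esub> x) y = c \<otimes>\<^bsub>F\<^esub> b x y \<and> b x (c \<odot>\<^bsub>A\<^esub> y) = c \<otimes>\<^bsub>F\<^esub> b x y)"

definition polar_form ::
  "('f, 'm) ring_scheme \<Rightarrow> ('f, 'a, 'n) module_scheme \<Rightarrow> ('a \<Rightarrow> 'f) \<Rightarrow> 'a \<Rightarrow> 'a \<Rightarrow> 'f" where
  "polar_form F A q x y = q (x \<oplus>\<^bsub>A\<^esub> y) \<ominus>\<^bsub>F\<^esub> q x \<ominus>\<^bsub>F\<^esub> q y"

definition quadratic_form ::
  "('f, 'm) ring_scheme \<Rightarrow> ('f, 'a, 'n) module_scheme \<Rightarrow> ('a \<Rightarrow> 'f) \<Rightarrow> bool" where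
  "quadratic_form F A q \<longleftrightarrow>
     (\<forall>x \<in> carrier A. q x \<in> carrier F) \<and>
     (\<forall>c \<in> carrier F. \<forall>x \<in> carrier A. q (c \<odot>\<^bsub>A\<^esub> x) = c \<otimes>\<^bsub>F\<^esub> c \<otimes>\<^bsub>F\<^esub> q x) \<and>
     bilinear_form F A (polar_form F A q)"


section \<open>Conic and Vidinli algebras\<close>

locale conic_algebra = nonassoc_algebra F A
  for F :: "('f, 'm) ring_scheme" and A :: "('f, 'a, 'n) module_scheme" (structure)
    and q :: "'a \<Rightarrow> 'f" +
  assumes alg_one_closed: "\<one>\<^bsub>A\<^esub> \<in> carrier A"
    and alg_l_one: "x \<in> carrier A \<Longrightarrow> \<one>\<^bsub>A\<^esub> \<otimes>\<^bsub>A\<^esub> x = x"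
    and alg_r_one: "x \<in> carrier A \<Longrightarrow> x \<otimes>\<^bsub>A\<^esub> \<one>\<^bsub>A\<^esub> = x"
    and norm_quadratic: "quadratic_form F A q"
    and norm_one: "q \<one>\<^bsub>A\<^esub> = \<one>\<^bsub>F\<^esub>"
    and norm_equation: "x \<in> carrier A \<Longrightarrow>
      x \<otimes>\<^bsub>A\<^esub> x \<ominus>\<^bsub>A\<^esub> polar_form F A q x \<one>\<^bsub>A\<^esub> \<odot>\<^bsub>A\<^esub> x \<oplus>\<^bsub>A\<^esub> q x \<odot>\<^bsub>A\<^esub> \<one>\<^bsub>A\<^esub> = \<zero>\<^bsub>A\<^esub>"

locale vidinli_algebra = conic_algebra F A q
  for F :: "('f, 'm) ring_scheme" and A :: "('f, 'a, 'n) module_scheme" (structure)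
    and q :: "'a \<Rightarrow> 'f" +
  assumes commutators_scalar:
    "span_commutator F A (carrier A) (carrier A) \<subseteq> {c \<odot>\<^bsub>A\<^esub> \<one>\<^bsub>A\<^esub> | c. c \<in> carrier F}"

text \<open>
  In a Vidinli algebra the scalar below exists by \<open>commutators_scalar\<close>, and it is unique
  because \<open>norm_one\<close> rules out that the unity is zero.
\<close>

definition vidinli_omega ::
  "('f, 'm) ring_scheme \<Rightarrow> ('f, 'a, 'n) module_scheme \<Rightarrow> 'a \<Rightarrow> 'a \<Rightarrow> 'f" where
  "vidinli_omega F A x y = (THE c. c \<in> carrier F \<and> commutator A x y = c \<odot>\<^bsub>A\<^esub> \<one>\<^bsub>A\<^esub>)"

definition vidinli_form ::
  "('f, 'm) ring_scheme \<Rightarrow> ('f, 'a, 'n) module_scheme \<Rightarrow> ('a \<Rightarrow> 'f) \<Rightarrow> 'a \<Rightarrow> 'a \<Rightarrow> 'f" where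
  "vidinli_form F A q x y =
     inv\<^bsub>F\<^esub> (\<one>\<^bsub>F\<^esub> \<oplus>\<^bsub>F\<^esub> \<one>\<^bsub>F\<^esub>) \<otimes>\<^bsub>F\<^esub> (polar_form F A q x y \<ominus>\<^bsub>F\<^esub> vidinli_omega F A x y)"

definition form_radical ::
  "('f, 'm) ring_scheme \<Rightarrow> ('f, 'a, 'n) module_scheme \<Rightarrow> ('a \<Rightarrow> 'a \<Rightarrow> 'f) \<Rightarrow> 'a set" where
  "form_radical F A b =
     {x \<in> carrier A. \<forall>y \<in> carrier A. b x y = \<zero>\<^bsub>F\<^esub> \<and> b y x = \<zero>\<^bsub>F\<^esub>}"

end

theory Submission
  imports Defs
begin

text \<open>
  Everything rests on one formula. Adding the linearized norm equation
  \<open>xy + yx = q(x,1)y + q(y,1)x - q(x,y)1\<close> to the commutator relation \<open>xy - yx = \<omega>(x,y)1\<close> and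
  halving gives, for the bilinear form \<open>B = (q - \<omega>)/2\<close>,
  \<open>xy = B(x,1)y + B(y,1)x - B(x,y)1\<close>,
  with \<open>B(1,1) = 1\<close> and \<open>B(1,x) = B(x,1)\<close>. The product is thus determined by the form, and the
  locale \<open>form_algebra\<close> isolates this situation; \<open>form_algebra_vidinli\<close> says that Vidinli algebras
  are instances of it.

  The formula makes the radical transparent: for \<open>r\<close> in \<open>rad B\<close> it reads \<open>xr = rx = B(x,1)r\<close>.
  Hence \<open>rad B\<close> is an ideal, and it squares to zero because \<open>B(r,1) = 0\<close> on it.

  Let \<open>I\<close> be a proper ideal and \<open>v \<in> I\<close>. Subtracting \<open>B(y,1)v\<close> from \<open>vy\<close> and from \<open>yv\<close> leaves
  \<open>B(v,1)y - B(v,y)1\<close> and \<open>B(v,1)y - B(y,v)1\<close> in \<open>I\<close>; as \<open>I\<close> contains no nonzero scalar, it follows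
  that \<open>B(v,y) = B(y,v)\<close>. If \<open>B(v,1) = 0\<close>, the same argument gives \<open>B(v,y) = 0\<close> for all \<open>y\<close>, so
  that \<open>v \<in> rad B\<close>. An ideal that is proper and not contained in \<open>rad B\<close> therefore contains a \<open>v\<close> with
  \<open>B(v,1) = 1\<close>, and then \<open>I\<close> is the kernel of \<open>\<phi> = B(v,\<cdot>)\<close> (\<open>proper_ideal_eq_kernel\<close>). There are two
  consequences. First, \<open>vv = 2v\<close>, so \<open>v/2\<close> is a nonzero idempotent, which survives in every
  term of the derived series: an ideal that is not contained in \<open>rad B\<close> is not solvable. Secondly, \<open>\<phi>\<close>
  and \<open>\<psi> = 2B(\<cdot>,1) - \<phi>\<close> are algebra homomorphisms to the field with common kernel \<open>rad B\<close>, and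
  together they identify the quotient by \<open>rad B\<close> with the square of the field
  (\<open>quot_isomorphic_square\<close>). If no such ideal exists, the quotient is simple.

  For the complement, the formula shows that every subspace containing \<open>1\<close> is closed under
  multiplication. So it is enough to enlarge the line of scalars, which meets \<open>rad B\<close>
  trivially, to a vector space complement of \<open>rad B\<close>; Zorn's lemma provides one in arbitrary
  dimension.
\<close>

section \<open>Submodules and ideals\<close>

context nonassoc_algebra
begin

lemma diff_zero:
  assumes "x \<in> carrier A"
  shows "x \<ominus> \<zero> = x"
proof -
  have "\<ominus> \<zero> = \<zero>"
    using M.r_neg[OF M.zero_closed] M.l_zero[OF M.a_inv_closed[OF M.zero_closed]] by metis
  then show ?thesis using assms by (simp add: M.minus_eq)
qed

lemma submodule_minus_closed:
  assumes "submodule V F A" "x \<in> V" "y \<in> V"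
  shows "x \<ominus> y \<in> V"
  using submoduleE(3,5)[OF assms(1)] assms(2,3) by (simp add: M.minus_eq)

lemma submodule_zero_closed:
  assumes "submodule V F A"
  shows "\<zero> \<in> V"
  using submodule.axioms(1)[OF assms] subgroup.one_closed by fastforce

lemma submodule_smult_cancel:
  assumes V: "submodule V F A" and c: "c \<in> carrier F" "c \<noteq> \<zero>\<^bsub>F\<^esub>"
    and x: "x \<in> carrier A" and cx: "c \<odot> x \<in> V"
  shows "x \<in> V"
proof -
  have i: "inv\<^bsub>F\<^esub> c \<in> carrier F" "inv\<^bsub>F\<^esub> c \<otimes>\<^bsub>F\<^esub> c = \<one>\<^bsub>F\<^esub>"
    using c F.field_Units by auto
  have "inv\<^bsub>F\<^esub> c \<odot> (c \<odot> x) = x"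
    using i c x by (simp flip: smult_assoc1)
  then show ?thesis
    using submoduleE(4)[OF V i(1) cx] by simp
qed

lemma submodule_zero: "submodule {\<zero>} F A"
  by (rule submoduleI) auto

lemma alg_idealD:
  assumes "alg_ideal F A I"
  shows "submodule I F A" "I \<subseteq> carrier A"
    and "\<And>x y. \<lbrakk>x \<in> carrier A; y \<in> I\<rbrakk> \<Longrightarrow> x \<otimes> y \<in> I"
    and "\<And>x y. \<lbrakk>x \<in> carrier A; y \<in> I\<rbrakk> \<Longrightarrow> y \<otimes> x \<in> I"
  using assms submoduleE(1) unfolding alg_ideal_def by auto

text \<open>Consequently an ideal containing a nonzero idempotent is not solvable.\<close>

lemma idempotent_in_derived_series:
  assumes "e \<in> I" "e \<otimes> e = e"
  shows "e \<in> derived_series F A I n"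
proof (induction n)
  case (Suc n)
  then have "e \<in> {u \<otimes> v | u v. u \<in> derived_series F A I n \<and> v \<in> derived_series F A I n}"
    using assms(2) by force
  then show ?case
    unfolding derived_series.simps span_prod_def lin_span_def by (rule hull_inc)
qed (use assms in simp)


section \<open>Sums and complements of subspaces\<close>

lemma submodule_line:
  assumes v: "v \<in> carrier A"
  shows "submodule {c \<odot> v | c. c \<in> carrier F} F A"
proof (rule submoduleI)
  show "\<zero> \<in> {c \<odot> v | c. c \<in> carrier F}"
    using smult_l_null[OF v] R.zero_closed by force
  show "\<ominus> x \<in> {c \<odot> v | c. c \<in> carrier F}" if "x \<in> {c \<odot> v | c. c \<in> carrier F}" for x
    using that v R.a_inv_closed by (force simp: smult_l_minus[symmetric])
  show "x \<oplus> y \<in> {c \<odot> v | c. c \<in> carrier F}"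
    if "x \<in> {c \<odot> v | c. c \<in> carrier F}" "y \<in> {c \<odot> v | c. c \<in> carrier F}" for x y
    using that v R.a_closed by (force simp: smult_l_distr[symmetric])
  show "a \<odot> x \<in> {c \<odot> v | c. c \<in> carrier F}"
    if "a \<in> carrier F" "x \<in> {c \<odot> v | c. c \<in> carrier F}" for a x
    using that v R.m_closed by (force simp: smult_assoc1[symmetric])
qed (use v in auto)

lemma submodule_set_add:
  assumes V: "submodule V F A" and W: "submodule W F A"
  shows "submodule (V <+>\<^bsub>A\<^esub> W) F A" "V \<subseteq> V <+>\<^bsub>A\<^esub> W" "W \<subseteq> V <+>\<^bsub>A\<^esub> W"
proof -
  note V' = submoduleE[OF V] and W' = submoduleE[OF W]
  have z: "\<zero> \<in> V" "\<zero> \<in> W" using V W submodule_zero_closed by auto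
  have mem: "x \<in> V <+>\<^bsub>A\<^esub> W \<longleftrightarrow> (\<exists>v \<in> V. \<exists>w \<in> W. x = v \<oplus> w)" for x
    by (auto simp: set_add_def')
  show sub: "V \<subseteq> V <+>\<^bsub>A\<^esub> W" "W \<subseteq> V <+>\<^bsub>A\<^esub> W"
    using z V'(1) W'(1) by (force simp: mem)+
  show "submodule (V <+>\<^bsub>A\<^esub> W) F A"
  proof (rule submoduleI)
    show "V <+>\<^bsub>A\<^esub> W \<subseteq> carrier A" using V'(1) W'(1) M.set_add_closed by blast
    show "\<zero> \<in> V <+>\<^bsub>A\<^esub> W" using z sub by blast
    show "\<ominus> x \<in> V <+>\<^bsub>A\<^esub> W" if x: "x \<in> V <+>\<^bsub>A\<^esub> W" for x
    proof -
      obtain v w where vw: "v \<in> V" "w \<in> W" "x = v \<oplus> w" using x mem by blast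
      then have "\<ominus> x = \<ominus> v \<oplus> \<ominus> w" using V'(1) W'(1) by (metis M.minus_add subsetD)
      then show ?thesis using vw V'(3) W'(3) mem by blast
    qed
    show "x \<oplus> y \<in> V <+>\<^bsub>A\<^esub> W" if x: "x \<in> V <+>\<^bsub>A\<^esub> W" and y: "y \<in> V <+>\<^bsub>A\<^esub> W" for x y
    proof -
      obtain v w where vw: "v \<in> V" "w \<in> W" "x = v \<oplus> w" using x mem by blast
      obtain v' w' where vw': "v' \<in> V" "w' \<in> W" "y = v' \<oplus> w'" using y mem by blast
      have "v \<in> carrier A" "w \<in> carrier A" "v' \<in> carrier A" "w' \<in> carrier A"
        using vw vw' V'(1) W'(1) by auto
      then have "x \<oplus> y = (v \<oplus> v') \<oplus> (w \<oplus> w')" using vw vw' by (simp add: M.a_ac)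
      then show ?thesis using vw vw' V'(5) W'(5) mem by blast
    qed
    show "a \<odot> x \<in> V <+>\<^bsub>A\<^esub> W" if a: "a \<in> carrier F" and x: "x \<in> V <+>\<^bsub>A\<^esub> W" for a x
    proof -
      obtain v w where vw: "v \<in> V" "w \<in> W" "x = v \<oplus> w" using x mem by blast
      then have "a \<odot> x = a \<odot> v \<oplus> a \<odot> w" using a V'(1) W'(1) by (metis smult_r_distr subsetD)
      then show ?thesis using a vw V'(4) W'(4) mem by blast
    qed
  qed
qed

lemma submodule_chain_Union:
  assumes ne: "\<C> \<noteq> {}" and sub: "\<And>V. V \<in> \<C> \<Longrightarrow> submodule V F A"
    and chain: "\<And>V W. \<lbrakk>V \<in> \<C>; W \<in> \<C>\<rbrakk> \<Longrightarrow> V \<subseteq> W \<or> W \<subseteq> V"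
  shows "submodule (\<Union>\<C>) F A"
proof (rule submoduleI)
  show "x \<oplus> y \<in> \<Union>\<C>" if x: "x \<in> \<Union>\<C>" and y: "y \<in> \<Union>\<C>" for x y
  proof -
    obtain V W where "V \<in> \<C>" "x \<in> V" "W \<in> \<C>" "y \<in> W" using x y by blast
    then obtain U where U: "U \<in> \<C>" "x \<in> U" "y \<in> U" using chain by blast
    then show ?thesis using submoduleE(5)[OF sub[OF U(1)] U(2,3)] by blast
  qed
  show "\<zero> \<in> \<Union>\<C>" using ne sub submodule_zero_closed by blast
qed (use submoduleE(1,3,4)[OF sub] in blast)+

text \<open>
  A maximal subspace \<open>S\<close> among those that contain \<open>U\<close> and meet \<open>R\<close> trivially is a complement: if
  \<open>v\<close> were outside \<open>S + R\<close>, then \<open>S + Fv\<close> would meet \<open>R\<close> in some \<open>s + cv \<noteq> 0\<close>, where \<open>c \<noteq> 0\<close>, and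
  solving for \<open>v\<close> would put it into \<open>S + R\<close> after all.
\<close>

lemma complement_of_submodule:
  assumes R: "submodule R F A" and U: "submodule U F A" and disj: "U \<inter> R = {\<zero>}"
  obtains S where "submodule S F A" "U \<subseteq> S" "S <+>\<^bsub>A\<^esub> R = carrier A" "S \<inter> R = {\<zero>}"
proof -
  let ?P = "{V. submodule V F A \<and> U \<subseteq> V \<and> V \<inter> R = {\<zero>}}"
  have "\<Union>\<C> \<in> ?P" if ne: "\<C> \<noteq> {}" and ch: "subset.chain ?P \<C>" for \<C>
  proof -
    have "submodule (\<Union>\<C>) F A"
      using ch by (intro submodule_chain_Union[OF ne]) (auto simp: subset_chain_def)
    then show ?thesis using ch ne by (auto simp: subset_chain_def)
  qed
  then obtain S where S: "S \<in> ?P" and max: "\<forall>M \<in> ?P. S \<subseteq> M \<longrightarrow> M = S"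
    using subset_Zorn_nonempty[of ?P] U disj by blast
  then have S': "submodule S F A" "U \<subseteq> S" "S \<inter> R = {\<zero>}" by auto
  note SR = submodule_set_add[OF S'(1) R]
  have "v \<in> S <+>\<^bsub>A\<^esub> R" if v: "v \<in> carrier A" for v
  proof (rule ccontr)
    assume nv: "v \<notin> S <+>\<^bsub>A\<^esub> R"
    let ?L = "{c \<odot> v | c. c \<in> carrier F}"
    note SL = submodule_set_add[OF S'(1) submodule_line[OF v]]
    have "v \<in> ?L" using v R.one_closed smult_one by force
    then have "S <+>\<^bsub>A\<^esub> ?L \<noteq> S" using SL(3) SR(2) nv by blast
    then have "(S <+>\<^bsub>A\<^esub> ?L) \<inter> R \<noteq> {\<zero>}" using max SL S'(2) by blast
    moreover have "\<zero> \<in> (S <+>\<^bsub>A\<^esub> ?L) \<inter> R"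
      using submodule_zero_closed[OF SL(1)] submodule_zero_closed[OF R] by blast
    ultimately obtain r where r: "r \<in> S <+>\<^bsub>A\<^esub> ?L" "r \<in> R" "r \<noteq> \<zero>" by blast
    then obtain s c where sc: "s \<in> S" "c \<in> carrier F" "r = s \<oplus> c \<odot> v"
      by (auto simp: set_add_def')
    have sA: "s \<in> carrier A" using sc(1) submoduleE(1)[OF S'(1)] by blast
    have "c \<noteq> \<zero>\<^bsub>F\<^esub>"
    proof
      assume "c = \<zero>\<^bsub>F\<^esub>"
      then have "r = s" using sc sA v by simp
      then show False using sc(1) r S'(3) by blast
    qed
    moreover have "c \<odot> v \<in> S <+>\<^bsub>A\<^esub> R"
    proof -
      have "c \<odot> v = r \<ominus> s"
        using sc sA v by (simp add: M.minus_eq M.a_ac M.r_neg1 M.r_neg2)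
      moreover have "r \<in> S <+>\<^bsub>A\<^esub> R" "s \<in> S <+>\<^bsub>A\<^esub> R" using SR(2,3) r(2) sc(1) by auto
      ultimately show ?thesis
        using submodule_minus_closed[OF SR(1)] by simp
    qed
    ultimately have "v \<in> S <+>\<^bsub>A\<^esub> R" by (intro submodule_smult_cancel[OF SR(1) sc(2) _ v])
    then show False using nv by contradiction
  qed
  then have "S <+>\<^bsub>A\<^esub> R = carrier A" using submoduleE(1)[OF SR(1)] by blast
  then show thesis using that S' by blast
qed


section \<open>Quotients\<close>

text \<open>
  Additively the quotient is the group of cosets. For products and multiples the choice of
  representatives is immaterial: \<open>(h + x)(k + y) = h(k + y) + xk + xy\<close>, where the first two terms
  lie in the ideal if \<open>h\<close> and \<open>k\<close> do.
\<close>

lemma alg_ideal_abelian_subgroup: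
  assumes "alg_ideal F A I"
  shows "abelian_subgroup I A"
  using submodule.axioms(1)[OF alg_idealD(1)[OF assms]] M.abelian_group_axioms
  by (intro abelian_subgroupI3 additive_subgroup.intro)

lemma coset_eq_iff:
  assumes "alg_ideal F A I" "x \<in> carrier A" "y \<in> carrier A"
  shows "I +> x = I +> y \<longleftrightarrow> x \<ominus> y \<in> I"
proof -
  interpret I: abelian_subgroup I A by (rule alg_ideal_abelian_subgroup[OF assms(1)])
  have "x \<in> I +> y \<longleftrightarrow> x \<ominus> y \<in> I"
    using assms by (simp add: I.a_rcos_module M.minus_eq)
  then show ?thesis
    using assms I.a_repr_independence'[of x y] I.a_repr_independenceD[of x y] by metis
qed

lemma coset_absorb:
  assumes "alg_ideal F A I" "h \<in> I" "x \<in> carrier A"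
  shows "I +> (h \<oplus> x) = I +> x"
proof -
  have h: "h \<in> carrier A" using assms alg_idealD(2) by blast
  have "(h \<oplus> x) \<ominus> x = h"
    using h assms(3) by (simp add: M.minus_eq M.a_assoc M.r_neg)
  then show ?thesis
    using coset_eq_iff[OF assms(1), of "h \<oplus> x" x] h assms by simp
qed

lemma coset_mult:
  assumes I: "alg_ideal F A I" and x: "x \<in> carrier A" and y: "y \<in> carrier A"
  shows "rcoset_mult A I (I +> x) (I +> y) = I +> (x \<otimes> y)"
proof -
  interpret I: abelian_subgroup I A by (rule alg_ideal_abelian_subgroup[OF I])
  have *: "I +> (a \<otimes> b) = I +> (x \<otimes> y)" if a: "a \<in> I +> x" and b: "b \<in> I +> y" for a b
  proof -
    obtain h k where h: "h \<in> I" "a = h \<oplus> x" and k: "k \<in> I" "b = k \<oplus> y"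
      using a b by (auto simp: a_r_coset_def')
    have hk: "h \<in> carrier A" "k \<in> carrier A" using h k alg_idealD(2)[OF I] by auto
    have "a \<otimes> b = (h \<otimes> b \<oplus> x \<otimes> k) \<oplus> x \<otimes> y"
      using h k hk x y by (simp add: alg_l_distr alg_r_distr alg_mult_closed M.a_ac)
    moreover have "h \<otimes> b \<oplus> x \<otimes> k \<in> I"
      using h k hk x y alg_idealD[OF I] submoduleE(5)[OF alg_idealD(1)[OF I]] by simp
    ultimately show ?thesis using coset_absorb[OF I] x y by (simp add: alg_mult_closed)
  qed
  show ?thesis
    unfolding rcoset_mult_def using * I.a_rcos_self[OF x] I.a_rcos_self[OF y] by blast
qed

lemma coset_smult:
  assumes I: "alg_ideal F A I" and c: "c \<in> carrier F" and x: "x \<in> carrier A"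
  shows "(\<Union>a \<in> I +> x. I +> (c \<odot> a)) = I +> (c \<odot> x)"
proof -
  interpret I: abelian_subgroup I A by (rule alg_ideal_abelian_subgroup[OF I])
  have *: "I +> (c \<odot> a) = I +> (c \<odot> x)" if a: "a \<in> I +> x" for a
  proof -
    obtain h where h: "h \<in> I" "a = h \<oplus> x"
      using a by (auto simp: a_r_coset_def')
    have hk: "h \<in> carrier A" using h alg_idealD(2)[OF I] by auto
    have "c \<odot> a = c \<odot> h \<oplus> c \<odot> x"
      using h hk x c by (simp add: smult_r_distr)
    moreover have "c \<odot> h \<in> I"
      using h c submoduleE(4)[OF alg_idealD(1)[OF I]] by simp
    ultimately show ?thesis using coset_absorb[OF I] x c by simp
  qed
  show ?thesis using * I.a_rcos_self[OF x] by blast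
qed

lemma carrier_quot: "carrier (quot_algebra A I) = (\<lambda>x. I +> x) ` carrier A"
  by (auto simp: quot_algebra_def ring.defs FactRing_def A_RCOSETS_def' )

lemma quot_ops:
  assumes I: "alg_ideal F A I"
  shows "\<zero>\<^bsub>quot_algebra A I\<^esub> = I" "\<one>\<^bsub>quot_algebra A I\<^esub> = I +> \<one>"
    and "\<And>x y. \<lbrakk>x \<in> carrier A; y \<in> carrier A\<rbrakk> \<Longrightarrow>
      (I +> x) \<oplus>\<^bsub>quot_algebra A I\<^esub> (I +> y) = I +> (x \<oplus> y)"
    and "\<And>x y. \<lbrakk>x \<in> carrier A; y \<in> carrier A\<rbrakk> \<Longrightarrow>
      (I +> x) \<otimes>\<^bsub>quot_algebra A I\<^esub> (I +> y) = I +> (x \<otimes> y)"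
    and "\<And>c x. \<lbrakk>c \<in> carrier F; x \<in> carrier A\<rbrakk> \<Longrightarrow>
      c \<odot>\<^bsub>quot_algebra A I\<^esub> (I +> x) = I +> (c \<odot> x)"
  using coset_mult[OF I] coset_smult[OF I]
    abelian_subgroup.a_rcos_sum[OF alg_ideal_abelian_subgroup[OF I]]
  by (auto simp: quot_algebra_def ring.defs FactRing_def)

lemma nonassoc_algebra_quot:
  assumes I: "alg_ideal F A I"
  shows "nonassoc_algebra F (quot_algebra A I)"
proof -
  let ?Q = "quot_algebra A I"
  interpret I: abelian_subgroup I A by (rule alg_ideal_abelian_subgroup[OF I])
  note q = quot_ops[OF I]
  have I_coset: "I = I +> \<zero>"
    using M.a_coset_add_zero[OF alg_idealD(2)[OF I]] by simp
  have "abelian_group ?Q"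
  proof (rule abelian_groupI)
    show "\<zero>\<^bsub>?Q\<^esub> \<in> carrier ?Q"
      using I_coset by (auto simp: carrier_quot q)
    fix K assume "K \<in> carrier ?Q"
    then obtain x where x: "x \<in> carrier A" "K = I +> x" by (auto simp: carrier_quot)
    show "\<zero>\<^bsub>?Q\<^esub> \<oplus>\<^bsub>?Q\<^esub> K = K"
      using x q(1) q(3)[of \<zero> x] I_coset by simp
    show "\<exists>L \<in> carrier ?Q. L \<oplus>\<^bsub>?Q\<^esub> K = \<zero>\<^bsub>?Q\<^esub>"
      using x q(1) q(3)[of "\<ominus> x" x] I_coset
      by (intro bexI[of _ "I +> \<ominus> x"]) (auto simp: carrier_quot M.l_neg)
  qed (auto simp: carrier_quot q M.a_ac)
  then have "module F ?Q"
    by (intro moduleI)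
      (auto simp: carrier_quot q smult_l_distr smult_r_distr smult_assoc1 R.is_cring)
  moreover have "nonassoc_algebra_axioms F ?Q"
    by unfold_locales
      (auto simp: carrier_quot q alg_mult_closed alg_l_distr alg_r_distr alg_smult_l alg_smult_r)
  ultimately show ?thesis
    using F.field_axioms by (intro nonassoc_algebra.intro)
qed

text \<open>
  The half of the correspondence theorem that transfers the study of ideals of the quotient to ideals
  of the algebra containing \<open>I\<close>.
\<close>

lemma alg_ideal_preimage:
  assumes I: "alg_ideal F A I" and J: "alg_ideal F (quot_algebra A I) J"
  defines "K \<equiv> {x \<in> carrier A. I +> x \<in> J}"
  shows "alg_ideal F A K" "I \<subseteq> K" "J = (\<lambda>x. I +> x) ` K"
proof -
  let ?Q = "quot_algebra A I"
  interpret Q: nonassoc_algebra F ?Q by (rule nonassoc_algebra_quot[OF I])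
  note q = quot_ops[OF I] and J' = Q.alg_idealD[OF J]
  note sub = Q.submoduleE[OF J'(1)]
  have zero: "I +> x = I" if "x \<in> I" for x
    using coset_absorb[OF I that M.zero_closed] that alg_idealD(2)[OF I]
    by (metis M.r_zero M.a_coset_add_zero subsetD)
  show "I \<subseteq> K"
    using zero alg_idealD(2)[OF I] Q.submodule_zero_closed[OF J'(1)] q(1) by (auto simp: K_def)
  show "J = (\<lambda>x. I +> x) ` K"
    using J'(2) by (auto simp: K_def carrier_quot)
  have smult: "c \<odot> x \<in> K" if "c \<in> carrier F" "x \<in> K" for c x
    using that sub(4)[of c "I +> x"] q(5) by (simp add: K_def)
  have "submodule K F A"
  proof (rule submoduleI)
    show "\<ominus> x \<in> K" if "x \<in> K" for x
    proof -
      have "\<ominus> x = (\<ominus>\<^bsub>F\<^esub> \<one>\<^bsub>F\<^esub>) \<odot> x"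
        using that by (simp add: K_def smult_l_minus)
      then show ?thesis using smult that by simp
    qed
    show "x \<oplus> y \<in> K" if "x \<in> K" "y \<in> K" for x y
      using that sub(5)[of "I +> x" "I +> y"] q(3) by (simp add: K_def)
  qed (use smult \<open>I \<subseteq> K\<close> submodule_zero_closed[OF alg_idealD(1)[OF I]] in \<open>auto simp: K_def\<close>)
  then show "alg_ideal F A K"
    unfolding alg_ideal_def
    using J'(3,4) q(4) by (fastforce simp: K_def carrier_quot alg_mult_closed)
qed

text \<open>
  The first isomorphism theorem. The isomorphism sends a coset to the only value that \<open>h\<close> takes on it.
\<close>

lemma quot_isomorphic:
  assumes I: "alg_ideal F A I" and one: "\<one> \<in> carrier A"
    and h: "h \<in> ring_hom A C"
    and lin: "\<And>c x. \<lbrakk>c \<in> carrier F; x \<in> carrier A\<rbrakk> \<Longrightarrow> h (c \<odot> x) = c \<odot>\<^bsub>C\<^esub> h x"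
    and surj: "h ` carrier A = carrier C"
    and ker: "\<And>x y. \<lbrakk>x \<in> carrier A; y \<in> carrier A\<rbrakk> \<Longrightarrow> h x = h y \<longleftrightarrow> x \<ominus> y \<in> I"
  shows "alg_isomorphic F (quot_algebra A I) C"
proof -
  let ?Q = "quot_algebra A I"
  interpret I: abelian_subgroup I A by (rule alg_ideal_abelian_subgroup[OF I])
  note q = quot_ops[OF I]
  define g where "g K = the_elem (h ` K)" for K
  have g: "g (I +> x) = h x" if x: "x \<in> carrier A" for x
  proof -
    have "h a = h x" if a: "a \<in> I +> x" for a
    proof -
      have "a \<in> carrier A" using I.a_elemrcos_carrier[OF x a] .
      then show ?thesis
        using ker[of a x] coset_eq_iff[OF I, of a x] x I.a_repr_independence'[OF a x] by simp
    qed
    then have "h ` (I +> x) = {h x}" using I.a_rcos_self[OF x] by blast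
    then show ?thesis by (simp add: g_def)
  qed
  have "g \<in> ring_hom ?Q C"
    using h one by (intro ring_hom_memI)
      (auto simp: carrier_quot q g ring_hom_closed ring_hom_mult ring_hom_add ring_hom_one
        alg_mult_closed)
  moreover have "bij_betw g (carrier ?Q) (carrier C)"
    unfolding bij_betw_def
  proof
    show "inj_on g (carrier ?Q)"
    proof (rule inj_onI)
      fix K L assume "K \<in> carrier ?Q" "L \<in> carrier ?Q" and eq: "g K = g L"
      then obtain x y where "x \<in> carrier A" "y \<in> carrier A" "K = I +> x" "L = I +> y"
        by (auto simp: carrier_quot)
      then show "K = L" using eq by (simp add: g ker coset_eq_iff[OF I])
    qed
    show "g ` carrier ?Q = carrier C"
      using surj g by (force simp: carrier_quot image_image)
  qed
  ultimately have "g \<in> ring_iso ?Q C" by (simp add: ring_iso_def)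
  moreover have "g (c \<odot>\<^bsub>?Q\<^esub> K) = c \<odot>\<^bsub>C\<^esub> g K" if "c \<in> carrier F" "K \<in> carrier ?Q" for c K
    using that by (auto simp: carrier_quot q g lin)
  ultimately show ?thesis unfolding alg_isomorphic_def by blast
qed

end

lemma square_algebra_ops:
  "carrier (square_algebra F) = carrier F \<times> carrier F"
  "\<one>\<^bsub>square_algebra F\<^esub> = (\<one>\<^bsub>F\<^esub>, \<one>\<^bsub>F\<^esub>)"
  "(a, c) \<oplus>\<^bsub>square_algebra F\<^esub> (a', c') = (a \<oplus>\<^bsub>F\<^esub> a', c \<oplus>\<^bsub>F\<^esub> c')"
  "(a, c) \<otimes>\<^bsub>square_algebra F\<^esub> (a', c') = (a \<otimes>\<^bsub>F\<^esub> a', c \<otimes>\<^bsub>F\<^esub> c')"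
  "d \<odot>\<^bsub>square_algebra F\<^esub> (a, c) = (d \<otimes>\<^bsub>F\<^esub> a, d \<otimes>\<^bsub>F\<^esub> c)"
  by (simp_all add: square_algebra_def ring.defs RDirProd_def DirProd_def monoid.defs)


section \<open>Algebras given by a bilinear form\<close>

text \<open>
  These axioms collect what the proof uses of a Vidinli algebra in characteristic other than \<open>2\<close>.
  By the product formula, \<open>1\<close> is a unity.
\<close>

locale form_algebra = nonassoc_algebra F A
  for F :: "('f, 'm) ring_scheme" and A :: "('f, 'a, 'n) module_scheme" (structure)
    and b :: "'a \<Rightarrow> 'a \<Rightarrow> 'f" +
  assumes one_closed: "\<one> \<in> carrier A"
    and form_bilinear: "bilinear_form F A b"
    and form_one_one: "b \<one> \<one> = \<one>\<^bsub>F\<^esub>"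
    and form_one_sym: "x \<in> carrier A \<Longrightarrow> b \<one> x = b x \<one>"
    and mult_eq: "\<lbrakk>x \<in> carrier A; y \<in> carrier A\<rbrakk> \<Longrightarrow>
      x \<otimes> y = (b x \<one> \<odot> y \<oplus> b y \<one> \<odot> x) \<ominus> b x y \<odot> \<one>"
    and two_nonzero: "\<one>\<^bsub>F\<^esub> \<oplus>\<^bsub>F\<^esub> \<one>\<^bsub>F\<^esub> \<noteq> \<zero>\<^bsub>F\<^esub>"
begin

abbreviation rad :: "'a set" where "rad \<equiv> form_radical F A b"

lemma form_closed [simp, intro]: "\<lbrakk>x \<in> carrier A; y \<in> carrier A\<rbrakk> \<Longrightarrow> b x y \<in> carrier F"
  using form_bilinear unfolding bilinear_form_def by blast

lemma form_add:
  assumes "x \<in> carrier A" "y \<in> carrier A" "z \<in> carrier A"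
  shows "b (x \<oplus> y) z = b x z \<oplus>\<^bsub>F\<^esub> b y z" "b z (x \<oplus> y) = b z x \<oplus>\<^bsub>F\<^esub> b z y"
  using form_bilinear assms unfolding bilinear_form_def by blast+

lemma form_smult:
  assumes "c \<in> carrier F" "x \<in> carrier A" "y \<in> carrier A"
  shows "b (c \<odot> x) y = c \<otimes>\<^bsub>F\<^esub> b x y" "b x (c \<odot> y) = c \<otimes>\<^bsub>F\<^esub> b x y"
  using form_bilinear assms unfolding bilinear_form_def by blast+

lemma form_neg:
  assumes "x \<in> carrier A" "y \<in> carrier A"
  shows "b (\<ominus> x) y = \<ominus>\<^bsub>F\<^esub> b x y" "b x (\<ominus> y) = \<ominus>\<^bsub>F\<^esub> b x y"
proof -
  have "\<ominus> z = (\<ominus>\<^bsub>F\<^esub> \<one>\<^bsub>F\<^esub>) \<odot> z" if "z \<in> carrier A" for z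
    using that by (simp add: smult_l_minus)
  then show "b (\<ominus> x) y = \<ominus>\<^bsub>F\<^esub> b x y" "b x (\<ominus> y) = \<ominus>\<^bsub>F\<^esub> b x y"
    using assms form_smult by (simp_all add: R.l_minus)
qed

lemma form_minus:
  assumes "x \<in> carrier A" "y \<in> carrier A" "z \<in> carrier A"
  shows "b (x \<ominus> y) z = b x z \<ominus>\<^bsub>F\<^esub> b y z" "b z (x \<ominus> y) = b z x \<ominus>\<^bsub>F\<^esub> b z y"
  using assms by (simp_all add: M.minus_eq R.minus_eq form_add form_neg)

lemma form_zero:
  assumes "x \<in> carrier A"
  shows "b \<zero> x = \<zero>\<^bsub>F\<^esub>" "b x \<zero> = \<zero>\<^bsub>F\<^esub>"
  using form_smult[of "\<zero>\<^bsub>F\<^esub>" \<zero> x] form_smult[of "\<zero>\<^bsub>F\<^esub>" x \<zero>] assms by simp_all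

lemma one_mult:
  assumes x: "x \<in> carrier A"
  shows "\<one> \<otimes> x = x" "x \<otimes> \<one> = x"
proof -
  let ?p = "b x \<one> \<odot> \<one>"
  have p: "?p \<in> carrier A" using x one_closed by simp
  then have "(x \<oplus> ?p) \<ominus> ?p = x"
    using x by (simp add: M.minus_eq M.a_assoc M.r_neg)
  then show "\<one> \<otimes> x = x" "x \<otimes> \<one> = x"
    using x p one_closed M.a_comm[OF p x]
    by (simp_all add: mult_eq form_one_one form_one_sym)
qed

lemma one_nonzero: "\<one> \<noteq> \<zero>"
  using form_one_one form_zero(1)[OF M.zero_closed] by auto

lemma scalar_in_submodule:
  assumes "submodule V F A" "\<one> \<notin> V" "c \<in> carrier F" "c \<odot> \<one> \<in> V"
  shows "c = \<zero>\<^bsub>F\<^esub>"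
  using submodule_smult_cancel assms one_closed by blast


section \<open>The radical of the form\<close>

lemma radD:
  assumes "r \<in> rad"
  shows "r \<in> carrier A" "\<And>y. y \<in> carrier A \<Longrightarrow> b r y = \<zero>\<^bsub>F\<^esub>"
    "\<And>y. y \<in> carrier A \<Longrightarrow> b y r = \<zero>\<^bsub>F\<^esub>"
  using assms unfolding form_radical_def by auto

lemma rad_mult:
  assumes r: "r \<in> rad" and x: "x \<in> carrier A"
  shows "x \<otimes> r = b x \<one> \<odot> r" "r \<otimes> x = b x \<one> \<odot> r"
  using radD[OF r] x one_closed by (simp_all add: mult_eq M.minus_eq)

lemma submodule_rad: "submodule rad F A"
  by (rule submoduleI)
    (auto simp: form_radical_def form_add form_smult form_neg form_zero)

lemma alg_ideal_rad: "alg_ideal F A rad"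
  unfolding alg_ideal_def
  using submodule_rad submoduleE(4)[OF submodule_rad form_closed[OF _ one_closed]]
  by (simp add: rad_mult)

lemma rad_square_zero: "span_prod F A rad rad = {\<zero>}"
proof -
  have "{u \<otimes> v |u v. u \<in> rad \<and> v \<in> rad} = {\<zero>}"
    using rad_mult radD submodule_zero_closed[OF submodule_rad] one_closed by force
  then show ?thesis
    unfolding span_prod_def lin_span_def
    using hull_same[of "\<lambda>V. submodule V F A", OF submodule_zero] by simp
qed

lemma one_notin_rad: "\<one> \<notin> rad"
  using form_one_one radD(2)[OF _ one_closed, of \<one>] by auto

lemma alg_ideal_with_one:
  assumes I: "alg_ideal F A I" and "\<one> \<in> I"
  shows "I = carrier A"
proof
  show "carrier A \<subseteq> I"
  proof
    fix x assume "x \<in> carrier A"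
    then show "x \<in> I" using alg_idealD(3)[OF I _ \<open>\<one> \<in> I\<close>, of x] one_mult by simp
  qed
qed (rule alg_idealD(2)[OF I])


section \<open>Ideals outside the radical\<close>

text \<open>
  The first element is \<open>vy - B(y,1)v\<close>. Starting from \<open>yv\<close> instead gives the same expression with
  \<open>B(y,v)\<close> in place of \<open>B(v,y)\<close>. The difference of the two is a scalar, and \<open>0\<close> is the only scalar in a
  proper ideal.
\<close>

lemma proper_ideal_form:
  assumes I: "alg_ideal F A I" and one: "\<one> \<notin> I" and v: "v \<in> I" and y: "y \<in> carrier A"
  shows "b v \<one> \<odot> y \<ominus> b v y \<odot> \<one> \<in> I" "b y v = b v y"
proof -
  note sub = alg_idealD(1)[OF I]
  have vA: "v \<in> carrier A" using alg_idealD(2)[OF I] v by blast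
  have yv: "b y \<one> \<odot> v \<in> I"
    by (rule submoduleE(4)[OF sub form_closed[OF y one_closed] v])
  have cancel: "((p \<oplus> s) \<ominus> r) \<ominus> s = p \<ominus> r"
    if "p \<in> carrier A" "s \<in> carrier A" "r \<in> carrier A" for p s r
  proof -
    have "((p \<oplus> s) \<ominus> r) \<ominus> s = p \<oplus> (s \<oplus> (\<ominus> s \<oplus> \<ominus> r))"
      using that by (simp add: M.minus_eq M.a_assoc M.a_comm[of "\<ominus> r" "\<ominus> s"])
    then show ?thesis using that by (simp add: M.r_neg2 M.minus_eq)
  qed
  have cancel2: "(p \<ominus> r) \<ominus> (p \<ominus> s) = s \<ominus> r"
    if "p \<in> carrier A" "s \<in> carrier A" "r \<in> carrier A" for p s r
  proof -
    have "(p \<ominus> r) \<ominus> (p \<ominus> s) = p \<oplus> (\<ominus> p \<oplus> (s \<oplus> \<ominus> r))"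
      using that by (simp add: M.minus_eq M.minus_add M.a_ac)
    then show ?thesis using that by (simp add: M.r_neg2 M.minus_eq)
  qed
  have eq1: "v \<otimes> y \<ominus> b y \<one> \<odot> v = b v \<one> \<odot> y \<ominus> b v y \<odot> \<one>"
    using vA y one_closed
    by (simp add: mult_eq cancel)
  have eq2: "y \<otimes> v \<ominus> b y \<one> \<odot> v = b v \<one> \<odot> y \<ominus> b y v \<odot> \<one>"
    using vA y one_closed M.a_comm[of "b y \<one> \<odot> v" "b v \<one> \<odot> y"]
    by (simp add: mult_eq cancel)
  show 1: "b v \<one> \<odot> y \<ominus> b v y \<odot> \<one> \<in> I"
    using submodule_minus_closed[OF sub alg_idealD(4)[OF I y v] yv] eq1 by simp
  have 2: "b v \<one> \<odot> y \<ominus> b y v \<odot> \<one> \<in> I"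
    using submodule_minus_closed[OF sub alg_idealD(3)[OF I y v] yv] eq2 by simp
  have "(b v \<one> \<odot> y \<ominus> b v y \<odot> \<one>) \<ominus> (b v \<one> \<odot> y \<ominus> b y v \<odot> \<one>)
      = (b y v \<ominus>\<^bsub>F\<^esub> b v y) \<odot> \<one>"
    using vA y one_closed by (simp add: cancel2) (simp add: R.minus_eq M.minus_eq smult_l_distr smult_l_minus)
  then have "(b y v \<ominus>\<^bsub>F\<^esub> b v y) \<odot> \<one> \<in> I"
    using submodule_minus_closed[OF sub 1 2] by simp
  then have "b y v \<ominus>\<^bsub>F\<^esub> b v y = \<zero>\<^bsub>F\<^esub>"
    by (rule scalar_in_submodule[OF sub one, rotated]) (use vA y in simp)
  then show "b y v = b v y" using vA y by (simp add: R.r_right_minus_eq)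
qed

text \<open>
  For such \<open>v\<close> the element \<open>B(v,1)y - B(v,y)1\<close> of \<open>I\<close> is itself a scalar, hence zero.
\<close>

lemma proper_ideal_form_one_zero:
  assumes I: "alg_ideal F A I" and one: "\<one> \<notin> I" and v: "v \<in> I" and tr: "b v \<one> = \<zero>\<^bsub>F\<^esub>"
  shows "v \<in> rad"
proof -
  have vA: "v \<in> carrier A" using alg_idealD(2)[OF I] v by blast
  have "b v y = \<zero>\<^bsub>F\<^esub> \<and> b y v = \<zero>\<^bsub>F\<^esub>" if y: "y \<in> carrier A" for y
  proof -
    have "\<ominus> (b v y \<odot> \<one>) \<in> I"
      using proper_ideal_form(1)[OF I one v y] tr y vA one_closed by (simp add: M.minus_eq)
    then have "b v y \<odot> \<one> \<in> I"
      using submoduleE(3)[OF alg_idealD(1)[OF I]] vA y one_closed by fastforce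
    then have "b v y = \<zero>\<^bsub>F\<^esub>"
      by (rule scalar_in_submodule[OF alg_idealD(1)[OF I] one, rotated]) (use vA y in simp)
    then show ?thesis using proper_ideal_form(2)[OF I one v y] by simp
  qed
  then show ?thesis unfolding form_radical_def using vA by blast
qed

text \<open>
  Normalizing an element outside the radical to \<open>B(v,1) = 1\<close> turns the elements of the ideal
  found above into \<open>y - B(v,y)1\<close>. Modulo \<open>I\<close>, every \<open>y\<close> is thus the scalar \<open>B(v,y)\<close>.
\<close>

lemma proper_ideal_eq_kernel:
  assumes I: "alg_ideal F A I" and one: "\<one> \<notin> I" and nr: "\<not> I \<subseteq> rad"
  shows "\<exists>v \<in> I. b v \<one> = \<one>\<^bsub>F\<^esub> \<and> I = {y \<in> carrier A. b v y = \<zero>\<^bsub>F\<^esub>}"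
proof -
  note sub = alg_idealD(1)[OF I]
  obtain w where w: "w \<in> I" "w \<notin> rad" using nr by blast
  then have wA: "w \<in> carrier A" using alg_idealD(2)[OF I] by blast
  have nz: "b w \<one> \<noteq> \<zero>\<^bsub>F\<^esub>" using proper_ideal_form_one_zero[OF I one] w by blast
  let ?c = "inv\<^bsub>F\<^esub> (b w \<one>)"
  have c: "?c \<in> carrier F" "?c \<otimes>\<^bsub>F\<^esub> b w \<one> = \<one>\<^bsub>F\<^esub>"
    using nz wA one_closed F.field_Units by auto
  define v where "v = ?c \<odot> w"
  have v: "v \<in> I" "b v \<one> = \<one>\<^bsub>F\<^esub>"
    using submoduleE(4)[OF sub c(1) w(1)] c wA one_closed by (simp_all add: v_def form_smult)
  have vA: "v \<in> carrier A" using alg_idealD(2)[OF I] v(1) by blast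
  have *: "y \<ominus> b v y \<odot> \<one> \<in> I" if "y \<in> carrier A" for y
    using proper_ideal_form(1)[OF I one v(1) that] v(2) that by simp
  have "y \<in> I \<longleftrightarrow> b v y = \<zero>\<^bsub>F\<^esub>" if y: "y \<in> carrier A" for y
  proof
    assume "b v y = \<zero>\<^bsub>F\<^esub>"
    then show "y \<in> I" using *[OF y] y one_closed by (simp add: diff_zero)
  next
    assume yI: "y \<in> I"
    have "y \<ominus> (y \<ominus> b v y \<odot> \<one>) = b v y \<odot> \<one>"
      using y vA one_closed by (simp add: M.minus_eq M.minus_add M.r_neg1 M.r_neg2)
    then have "b v y \<odot> \<one> \<in> I"
      using submodule_minus_closed[OF sub yI *[OF y]] by simp
    then show "b v y = \<zero>\<^bsub>F\<^esub>"
      by (rule scalar_in_submodule[OF sub one, rotated]) (use vA y in simp)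
  qed
  then have "I = {y \<in> carrier A. b v y = \<zero>\<^bsub>F\<^esub>}"
    using alg_idealD(2)[OF I] by auto
  then show ?thesis using v by (intro bexI[of _ v] conjI)
qed

text \<open>
  If the ideal is proper, the element \<open>v\<close> of the previous lemma satisfies \<open>B(v,v) = 0\<close>, as \<open>v\<close>
  lies in the kernel of \<open>B(v,\<cdot>)\<close>; so \<open>vv = 2v\<close> and \<open>v/2\<close> is idempotent.
\<close>

lemma idempotent_in_ideal:
  assumes I: "alg_ideal F A I" and nr: "\<not> I \<subseteq> rad"
  obtains e where "e \<in> I" "e \<otimes> e = e" "e \<noteq> \<zero>"
proof (cases "\<one> \<in> I")
  case True
  then show thesis using that one_mult(1)[OF one_closed] one_nonzero by simp
next
  case False
  obtain v where v: "v \<in> I" "b v \<one> = \<one>\<^bsub>F\<^esub>"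
    and ker: "I = {y \<in> carrier A. b v y = \<zero>\<^bsub>F\<^esub>}"
    using proper_ideal_eq_kernel[OF I False nr] by (elim bexE conjE)
  have vA: "v \<in> carrier A" using alg_idealD(2)[OF I] v(1) by blast
  let ?h = "inv\<^bsub>F\<^esub> (\<one>\<^bsub>F\<^esub> \<oplus>\<^bsub>F\<^esub> \<one>\<^bsub>F\<^esub>)"
  have h: "?h \<in> carrier F" "?h \<otimes>\<^bsub>F\<^esub> (\<one>\<^bsub>F\<^esub> \<oplus>\<^bsub>F\<^esub> \<one>\<^bsub>F\<^esub>) = \<one>\<^bsub>F\<^esub>"
    using two_nonzero F.field_Units by auto
  have vb: "b v v = \<zero>\<^bsub>F\<^esub>" using v(1) ker by simp
  have vv: "v \<otimes> v = (\<one>\<^bsub>F\<^esub> \<oplus>\<^bsub>F\<^esub> \<one>\<^bsub>F\<^esub>) \<odot> v"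
    using vb v(2) vA one_closed by (simp add: mult_eq smult_l_distr diff_zero)
  have "(?h \<odot> v) \<otimes> (?h \<odot> v) = ?h \<odot> (?h \<odot> ((\<one>\<^bsub>F\<^esub> \<oplus>\<^bsub>F\<^esub> \<one>\<^bsub>F\<^esub>) \<odot> v))"
    using h vA by (simp add: alg_smult_l alg_smult_r vv)
  also have "\<dots> = ?h \<odot> ((?h \<otimes>\<^bsub>F\<^esub> (\<one>\<^bsub>F\<^esub> \<oplus>\<^bsub>F\<^esub> \<one>\<^bsub>F\<^esub>)) \<odot> v)"
    using h(1) vA by (simp only: smult_assoc1 R.add.m_closed R.one_closed)
  also have "\<dots> = ?h \<odot> v" using h vA by simp
  finally have idem: "(?h \<odot> v) \<otimes> (?h \<odot> v) = ?h \<odot> v" .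
  have hnz: "?h \<noteq> \<zero>\<^bsub>F\<^esub>" using h(2) by auto
  have "v \<noteq> \<zero>" using v(2) form_zero one_closed by auto
  then have "?h \<odot> v \<noteq> \<zero>"
    using submodule_smult_cancel[OF submodule_zero h(1) hnz vA] by blast
  with submoduleE(4)[OF alg_idealD(1)[OF I] h(1) v(1)] idem show thesis by (rule that)
qed

lemma solvable_rad: "solvable_ideal F A rad"
proof -
  have "derived_series F A rad 1 = {\<zero>}" using rad_square_zero by simp
  then show ?thesis unfolding solvable_ideal_def using alg_ideal_rad by blast
qed

lemma solvable_in_rad:
  assumes "solvable_ideal F A I"
  shows "I \<subseteq> rad"
proof (rule ccontr)
  assume "\<not> I \<subseteq> rad"
  then obtain e where e: "e \<in> I" "e \<otimes> e = e" and "e \<noteq> \<zero>"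
    using idempotent_in_ideal assms unfolding solvable_ideal_def by blast
  have "e \<in> derived_series F A I n" for n by (rule idempotent_in_derived_series[OF e])
  then show False using assms \<open>e \<noteq> \<zero>\<close> unfolding solvable_ideal_def by blast
qed


section \<open>A complementary subalgebra\<close>

text \<open>By the product formula, \<open>xy\<close> lies in the span of \<open>1\<close>, \<open>x\<close> and \<open>y\<close>.\<close>

lemma submodule_with_one_subalgebra:
  assumes S: "submodule S F A" and one: "\<one> \<in> S"
  shows "unital_subalgebra F A S"
proof -
  have "x \<otimes> y \<in> S" if "x \<in> S" "y \<in> S" for x y
  proof -
    have "x \<in> carrier A" "y \<in> carrier A" using that submoduleE(1)[OF S] by auto
    then show ?thesis
      using that one one_closed submoduleE(4,5)[OF S] submodule_minus_closed[OF S]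
      by (simp add: mult_eq)
  qed
  then show ?thesis using S one unfolding unital_subalgebra_def by blast
qed

lemma rad_complement:
  obtains S where "unital_subalgebra F A S" "S <+>\<^bsub>A\<^esub> rad = carrier A" "S \<inter> rad = {\<zero>}"
proof -
  let ?U = "{c \<odot> \<one> | c. c \<in> carrier F}"
  have U: "submodule ?U F A" by (rule submodule_line[OF one_closed])
  have "?U \<inter> rad \<subseteq> {\<zero>}"
    using scalar_in_submodule[OF submodule_rad one_notin_rad] one_closed smult_l_null by blast
  then have "?U \<inter> rad = {\<zero>}"
    using submodule_zero_closed[OF U] submodule_zero_closed[OF submodule_rad] by blast
  then obtain S where S: "submodule S F A" "?U \<subseteq> S" "S <+>\<^bsub>A\<^esub> rad = carrier A" "S \<inter> rad = {\<zero>}"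
    using complement_of_submodule[OF submodule_rad U] by blast
  have "\<one> \<in> ?U" using one_closed R.one_closed smult_one by force
  then show thesis using that submodule_with_one_subalgebra S by blast
qed


section \<open>The quotient by the radical\<close>

lemma double_eq_zero:
  assumes "c \<in> carrier F" "c \<oplus>\<^bsub>F\<^esub> c = \<zero>\<^bsub>F\<^esub>"
  shows "c = \<zero>\<^bsub>F\<^esub>"
proof -
  have "(\<one>\<^bsub>F\<^esub> \<oplus>\<^bsub>F\<^esub> \<one>\<^bsub>F\<^esub>) \<otimes>\<^bsub>F\<^esub> c = \<zero>\<^bsub>F\<^esub>"
    using assms by (simp add: R.l_distr)
  then show ?thesis using two_nonzero assms(1) F.integral by blast
qed

text \<open>
  The map \<open>\<phi> = B(v,\<cdot>)\<close> is the projection of \<open>A = F1 + I\<close> onto \<open>F1\<close>, hence multiplicative because \<open>I\<close> is an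
  ideal. Comparing \<open>\<phi>(xy) = \<phi>(x)\<phi>(y)\<close> with the product formula expresses \<open>B(x,y)\<close> through \<open>\<phi>\<close> and
  \<open>B(\<cdot>,1)\<close>, and with this expression the conjugate character \<open>\<psi> = 2B(\<cdot>,1) - \<phi>\<close> is multiplicative
  as well. Their common kernel consists of the elements of \<open>I\<close> with \<open>B(z,1) = 0\<close>, which is the radical.
\<close>

lemma quot_isomorphic_square:
  assumes I: "alg_ideal F A I" and one: "\<one> \<notin> I" and nr: "\<not> I \<subseteq> rad"
  shows "alg_isomorphic F (quot_algebra A rad) (square_algebra F)"
proof -
  obtain v where v: "v \<in> I" "b v \<one> = \<one>\<^bsub>F\<^esub>"
    and I_eq: "I = {y \<in> carrier A. b v y = \<zero>\<^bsub>F\<^esub>}"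
    using proper_ideal_eq_kernel[OF I one nr] by (elim bexE conjE)
  have ker: "y \<in> I \<longleftrightarrow> b v y = \<zero>\<^bsub>F\<^esub>" if "y \<in> carrier A" for y
    using I_eq that by simp
  have vA: "v \<in> carrier A" using alg_idealD(2)[OF I] v(1) by blast
  define \<phi> where "\<phi> y = b v y" for y
  define \<psi> where "\<psi> y = (b y \<one> \<oplus>\<^bsub>F\<^esub> b y \<one>) \<ominus>\<^bsub>F\<^esub> \<phi> y" for y
  have closed: "\<phi> y \<in> carrier F" "\<psi> y \<in> carrier F" if "y \<in> carrier A" for y
    using that vA one_closed by (auto simp: \<phi>_def \<psi>_def)
  \<comment> \<open>Write \<open>x = x' + \<phi>(x)1\<close> with \<open>x'\<close> in the ideal \<open>I\<close>, on which \<open>\<phi>\<close> vanishes.\<close>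
  have \<phi>_mult: "\<phi> (x \<otimes> y) = \<phi> x \<otimes>\<^bsub>F\<^esub> \<phi> y" if x: "x \<in> carrier A" and y: "y \<in> carrier A" for x y
  proof -
    define x' where "x' = x \<ominus> \<phi> x \<odot> \<one>"
    have x'A: "x' \<in> carrier A" using x one_closed closed by (simp add: x'_def)
    have "\<phi> x' = \<zero>\<^bsub>F\<^esub>"
      using x one_closed vA v(2) closed[OF x]
      by (simp add: x'_def \<phi>_def form_minus form_smult R.minus_eq R.r_neg)
    then have "x' \<in> I" using ker[OF x'A] by (simp add: \<phi>_def)
    then have 0: "\<phi> (x' \<otimes> y) = \<zero>\<^bsub>F\<^esub>"
      using alg_idealD(4)[OF I y] ker[OF alg_mult_closed[OF x'A y]] by (simp add: \<phi>_def)
    have "x = x' \<oplus> \<phi> x \<odot> \<one>"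
      using x one_closed closed[OF x] by (simp add: x'_def M.minus_eq M.a_assoc M.l_neg)
    then have "x \<otimes> y = x' \<otimes> y \<oplus> \<phi> x \<odot> y"
      using x'A x y closed[OF x] one_closed
      by (metis alg_l_distr alg_smult_l one_mult(1) smult_closed)
    then show ?thesis
      using 0 x'A y vA closed[OF x] by (simp add: \<phi>_def form_add form_smult alg_mult_closed)
  qed
  have b_eq: "b x y = (b x \<one> \<otimes>\<^bsub>F\<^esub> \<phi> y \<oplus>\<^bsub>F\<^esub> b y \<one> \<otimes>\<^bsub>F\<^esub> \<phi> x) \<ominus>\<^bsub>F\<^esub> \<phi> x \<otimes>\<^bsub>F\<^esub> \<phi> y"
    if x: "x \<in> carrier A" and y: "y \<in> carrier A" for x y
  proof -
    have "\<phi> (x \<otimes> y) = (b x \<one> \<otimes>\<^bsub>F\<^esub> \<phi> y \<oplus>\<^bsub>F\<^esub> b y \<one> \<otimes>\<^bsub>F\<^esub> \<phi> x) \<ominus>\<^bsub>F\<^esub> b x y"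
      using x y vA one_closed v(2) by (simp add: mult_eq \<phi>_def form_add form_smult form_minus)
    moreover have "b x y = s \<ominus>\<^bsub>F\<^esub> p" if "p = s \<ominus>\<^bsub>F\<^esub> b x y" "s \<in> carrier F" for s p
      unfolding that(1) using that(2) x y
      by (simp add: R.minus_eq R.minus_add R.r_neg2)
    ultimately show ?thesis
      using \<phi>_mult[OF x y] closed x y one_closed by simp
  qed
  have \<psi>_mult: "\<psi> (x \<otimes> y) = \<psi> x \<otimes>\<^bsub>F\<^esub> \<psi> y" if x: "x \<in> carrier A" and y: "y \<in> carrier A" for x y
  proof -
    have "b (x \<otimes> y) \<one> = (b x \<one> \<otimes>\<^bsub>F\<^esub> b y \<one> \<oplus>\<^bsub>F\<^esub> b y \<one> \<otimes>\<^bsub>F\<^esub> b x \<one>) \<ominus>\<^bsub>F\<^esub> b x y"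
      using x y one_closed by (simp add: mult_eq form_add form_smult form_minus form_one_one)
    then show ?thesis
      unfolding \<psi>_def \<phi>_mult[OF x y] b_eq[OF x y]
      using form_closed[OF x one_closed] form_closed[OF y one_closed] closed[OF x] closed[OF y]
      by algebra
  qed
  have \<psi>_minus: "\<psi> (x \<ominus> y) = \<psi> x \<ominus>\<^bsub>F\<^esub> \<psi> y" if x: "x \<in> carrier A" and y: "y \<in> carrier A" for x y
    using form_closed[OF x one_closed] form_closed[OF y one_closed] closed[OF x] closed[OF y]
    unfolding \<psi>_def \<phi>_def form_minus[OF x y one_closed] form_minus[OF x y vA] by algebra
  have \<psi>_add: "\<psi> (x \<oplus> y) = \<psi> x \<oplus>\<^bsub>F\<^esub> \<psi> y" if x: "x \<in> carrier A" and y: "y \<in> carrier A" for x y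
    using form_closed[OF x one_closed] form_closed[OF y one_closed] closed[OF x] closed[OF y]
    unfolding \<psi>_def \<phi>_def form_add[OF x y one_closed] form_add[OF x y vA] by algebra
  have \<psi>_smult: "\<psi> (c \<odot> x) = c \<otimes>\<^bsub>F\<^esub> \<psi> x" if c: "c \<in> carrier F" and x: "x \<in> carrier A" for c x
    using form_closed[OF x one_closed] closed[OF x] c
    unfolding \<psi>_def \<phi>_def form_smult(1)[OF c x one_closed] form_smult(2)[OF c vA x] by algebra
  have rad_iff: "z \<in> rad \<longleftrightarrow> \<phi> z = \<zero>\<^bsub>F\<^esub> \<and> \<psi> z = \<zero>\<^bsub>F\<^esub>" if z: "z \<in> carrier A" for z
  proof
    assume "z \<in> rad"
    then show "\<phi> z = \<zero>\<^bsub>F\<^esub> \<and> \<psi> z = \<zero>\<^bsub>F\<^esub>"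
      using radD vA one_closed by (simp add: \<phi>_def \<psi>_def R.minus_eq)
  next
    assume "\<phi> z = \<zero>\<^bsub>F\<^esub> \<and> \<psi> z = \<zero>\<^bsub>F\<^esub>"
    then have *: "\<phi> z = \<zero>\<^bsub>F\<^esub>" "\<psi> z = \<zero>\<^bsub>F\<^esub>" by auto
    have "b z \<one> \<oplus>\<^bsub>F\<^esub> b z \<one> = \<zero>\<^bsub>F\<^esub>"
      using *(2) form_closed[OF z one_closed] unfolding \<psi>_def *(1) by (simp add: R.minus_eq)
    then have "b z \<one> = \<zero>\<^bsub>F\<^esub>"
      by (rule double_eq_zero[OF form_closed[OF z one_closed]])
    moreover have "z \<in> I" using * ker[OF z] by (simp add: \<phi>_def)
    ultimately show "z \<in> rad" by (intro proper_ideal_form_one_zero[OF I one])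
  qed
  have \<phi>_lin: "\<phi> (x \<oplus> y) = \<phi> x \<oplus>\<^bsub>F\<^esub> \<phi> y" "\<phi> (x \<ominus> y) = \<phi> x \<ominus>\<^bsub>F\<^esub> \<phi> y"
    "\<phi> (c \<odot> x) = c \<otimes>\<^bsub>F\<^esub> \<phi> x"
    if "c \<in> carrier F" "x \<in> carrier A" "y \<in> carrier A" for c x y
    using that vA by (simp_all add: \<phi>_def form_add form_minus form_smult)
  have unit: "\<phi> \<one> = \<one>\<^bsub>F\<^esub>" "\<psi> \<one> = \<one>\<^bsub>F\<^esub>"
    using v(2) by (simp_all add: \<phi>_def \<psi>_def form_one_one R.minus_eq R.a_assoc R.r_neg)
  let ?C = "square_algebra F" and ?two = "\<one>\<^bsub>F\<^esub> \<oplus>\<^bsub>F\<^esub> \<one>\<^bsub>F\<^esub>"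
  define h where "h y = (\<phi> y, \<psi> y)" for y
  have h_ring: "h \<in> ring_hom A ?C"
    by (rule ring_hom_memI)
      (simp_all add: h_def square_algebra_ops closed \<phi>_mult \<psi>_mult \<phi>_lin[OF R.zero_closed] \<psi>_add unit)
  have h_smult: "h (c \<odot> x) = c \<odot>\<^bsub>?C\<^esub> h x" if c: "c \<in> carrier F" and x: "x \<in> carrier A" for c x
    by (simp only: h_def square_algebra_ops \<phi>_lin(3)[OF c x x] \<psi>_smult[OF c x])
  have vv: "\<phi> v = \<zero>\<^bsub>F\<^esub>" "\<psi> v = ?two"
    using ker[OF vA] v by (simp_all add: \<psi>_def \<phi>_def R.minus_eq)
  have h_onto: "(s, t) \<in> h ` carrier A" if s: "s \<in> carrier F" and t: "t \<in> carrier F" for s t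
  proof -
    have i: "inv\<^bsub>F\<^esub> ?two \<in> carrier F" "inv\<^bsub>F\<^esub> ?two \<otimes>\<^bsub>F\<^esub> ?two = \<one>\<^bsub>F\<^esub>"
      using two_nonzero F.field_Units by auto
    \<comment> \<open>As \<open>h\<close> maps \<open>1\<close> to \<open>(1, 1)\<close> and \<open>v\<close> to \<open>(0, 2)\<close>, it maps \<open>s1 + ((t - s)/2)v\<close> to \<open>(s, t)\<close>.\<close>
    define d where "d = (t \<ominus>\<^bsub>F\<^esub> s) \<otimes>\<^bsub>F\<^esub> inv\<^bsub>F\<^esub> ?two"
    have d: "d \<in> carrier F" "d \<otimes>\<^bsub>F\<^esub> ?two = t \<ominus>\<^bsub>F\<^esub> s"
      using i s t by (simp_all add: d_def R.m_assoc)
    let ?x = "s \<odot> \<one> \<oplus> d \<odot> v"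
    have x: "s \<odot> \<one> \<in> carrier A" "d \<odot> v \<in> carrier A" using s d(1) vA one_closed by simp_all
    have "\<phi> ?x = s"
      unfolding \<phi>_lin(1)[OF s x] \<phi>_lin(3)[OF s one_closed one_closed] \<phi>_lin(3)[OF d(1) vA vA]
        vv unit using s d(1) by simp
    moreover have "\<psi> ?x = s \<oplus>\<^bsub>F\<^esub> (t \<ominus>\<^bsub>F\<^esub> s)"
      unfolding \<psi>_add[OF x] \<psi>_smult[OF s one_closed] \<psi>_smult[OF d(1) vA] vv unit d(2)
      using s by simp
    moreover have "s \<oplus>\<^bsub>F\<^esub> (t \<ominus>\<^bsub>F\<^esub> s) = t" using s t by algebra
    ultimately have "(s, t) = h ?x" by (simp add: h_def)
    then show ?thesis using x by (intro image_eqI[of _ _ ?x]) simp_all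
  qed
  have h_image: "h ` carrier A = carrier ?C"
    unfolding square_algebra_ops using h_onto closed by (auto simp: h_def)
  have h_ker: "h x = h y \<longleftrightarrow> x \<ominus> y \<in> rad" if x: "x \<in> carrier A" and y: "y \<in> carrier A" for x y
    unfolding rad_iff[OF M.minus_closed[OF x y]] \<phi>_lin(2)[OF R.zero_closed x y] \<psi>_minus[OF x y]
    using closed x y by (simp add: h_def R.r_right_minus_eq)
  show ?thesis
    by (rule quot_isomorphic[OF alg_ideal_rad one_closed h_ring h_smult h_image h_ker])
qed

text \<open>
  An ideal of the quotient comes from an ideal \<open>K\<close> containing the radical. If \<open>K\<close> contains \<open>1\<close>, it
  is everything; if it lies in the radical, it is the radical; otherwise the quotient splits.
\<close>

lemma quot_simple_or_square:
  "simple_algebra F (quot_algebra A rad)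
    \<or> alg_isomorphic F (quot_algebra A rad) (square_algebra F)"
proof (rule disjCI)
  let ?Q = "quot_algebra A rad"
  assume not_square: "\<not> alg_isomorphic F ?Q (square_algebra F)"
  note q = quot_ops[OF alg_ideal_rad]
  have coset_rad: "rad +> x = rad \<longleftrightarrow> x \<in> rad" if x: "x \<in> carrier A" for x
  proof -
    have "rad = rad +> \<zero>"
      using M.a_coset_add_zero[OF alg_idealD(2)[OF alg_ideal_rad]] by simp
    then show ?thesis
      using coset_eq_iff[OF alg_ideal_rad x M.zero_closed] diff_zero[OF x] by simp
  qed
  have "J = {\<zero>\<^bsub>?Q\<^esub>} \<or> J = carrier ?Q" if J: "alg_ideal F ?Q J" for J
  proof -
    define K where "K = {x \<in> carrier A. rad +> x \<in> J}"
    note K = alg_ideal_preimage[OF alg_ideal_rad J, folded K_def]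
    show ?thesis
    proof (cases "\<one> \<in> K")
      case True
      then have "K = carrier A" by (rule alg_ideal_with_one[OF K(1)])
      then have "J = carrier ?Q" unfolding K(3) carrier_quot by (rule arg_cong)
      then show ?thesis ..
    next
      case False
      have "K \<subseteq> rad"
      proof (rule ccontr)
        assume "\<not> K \<subseteq> rad"
        then have "alg_isomorphic F ?Q (square_algebra F)"
          by (rule quot_isomorphic_square[OF K(1) False])
        with not_square show False by contradiction
      qed
      then have "K = rad" using K(2) by (rule subset_antisym)
      then have "J = (\<lambda>x. rad +> x) ` rad" unfolding K(3) by (rule arg_cong)
      also have "\<dots> = (\<lambda>x. rad) ` rad"
        by (rule image_cong) (simp_all add: coset_rad radD(1))
      also have "\<dots> = {rad}"
        using submodule_zero_closed[OF submodule_rad] by auto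
      finally show ?thesis unfolding q(1) ..
    qed
  qed
  moreover have "rad +> \<one> \<in> carrier ?Q" using one_closed by (auto simp: carrier_quot)
  moreover have "(rad +> \<one>) \<otimes>\<^bsub>?Q\<^esub> (rad +> \<one>) \<noteq> \<zero>\<^bsub>?Q\<^esub>"
    using q(1) q(4)[OF one_closed one_closed] one_mult(1) one_closed coset_rad one_notin_rad by simp
  ultimately show "simple_algebra F ?Q"
    using nonassoc_algebra_quot[OF alg_ideal_rad] unfolding simple_algebra_def by blast
qed

end


section \<open>Vidinli algebras\<close>

context vidinli_algebra
begin

abbreviation "P \<equiv> polar_form F A q"
abbreviation "W \<equiv> vidinli_omega F A"

lemma norm_closed: "x \<in> carrier A \<Longrightarrow> q x \<in> carrier F"
  using norm_quadratic unfolding quadratic_form_def by blast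

lemma polar_bilinear: "bilinear_form F A P"
  using norm_quadratic unfolding quadratic_form_def by blast

lemma polar_closed: "\<lbrakk>x \<in> carrier A; y \<in> carrier A\<rbrakk> \<Longrightarrow> P x y \<in> carrier F"
  using polar_bilinear unfolding bilinear_form_def by blast

lemma polar_sym: "\<lbrakk>x \<in> carrier A; y \<in> carrier A\<rbrakk> \<Longrightarrow> P x y = P y x"
  unfolding polar_form_def using norm_closed by (simp add: M.a_comm R.minus_eq R.a_ac)

lemma alg_one_nonzero: "\<one> \<noteq> \<zero>"
proof
  assume "\<one> = \<zero>"
  have "q (\<zero>\<^bsub>F\<^esub> \<odot> \<zero>) = \<zero>\<^bsub>F\<^esub> \<otimes>\<^bsub>F\<^esub> \<zero>\<^bsub>F\<^esub> \<otimes>\<^bsub>F\<^esub> q \<zero>"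
    using norm_quadratic unfolding quadratic_form_def by blast
  then have "q \<zero> = \<zero>\<^bsub>F\<^esub>" using norm_closed[OF M.zero_closed] by simp
  then show False using norm_one \<open>\<one> = \<zero>\<close> by simp
qed

lemma scalar_inj:
  assumes "c \<in> carrier F" "d \<in> carrier F" "c \<odot> \<one> = d \<odot> \<one>"
  shows "c = d"
proof -
  have "(c \<ominus>\<^bsub>F\<^esub> d) \<odot> \<one> \<in> {\<zero>}"
    using assms alg_one_closed by (simp add: R.minus_eq smult_l_distr smult_l_minus M.r_neg)
  then have "c \<ominus>\<^bsub>F\<^esub> d = \<zero>\<^bsub>F\<^esub>"
    using submodule_smult_cancel[OF submodule_zero, of "c \<ominus>\<^bsub>F\<^esub> d" \<one>] assms alg_one_closed
      alg_one_nonzero by auto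
  then show ?thesis using assms by (simp add: R.r_right_minus_eq)
qed

lemma omega_unique:
  assumes "c \<in> carrier F" "commutator A x y = c \<odot> \<one>"
  shows "W x y = c"
  unfolding vidinli_omega_def using assms scalar_inj by (intro the_equality) auto

lemma omega:
  assumes "x \<in> carrier A" "y \<in> carrier A"
  shows "W x y \<in> carrier F" "commutator A x y = W x y \<odot> \<one>"
proof -
  have "commutator A x y \<in> span_commutator F A (carrier A) (carrier A)"
    unfolding span_commutator_def lin_span_def using assms by (intro hull_inc) blast
  then obtain c where "c \<in> carrier F" "commutator A x y = c \<odot> \<one>"
    using commutators_scalar by blast
  then show "W x y \<in> carrier F" "commutator A x y = W x y \<odot> \<one>"
    using omega_unique by auto
qed

lemma omega_bilinear: "bilinear_form F A W"
proof -
  have "W (x \<oplus> y) z = W x z \<oplus>\<^bsub>F\<^esub> W y z \<and> W z (x \<oplus> y) = W z x \<oplus>\<^bsub>F\<^esub> W z y"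
    if x: "x \<in> carrier A" and y: "y \<in> carrier A" and z: "z \<in> carrier A" for x y z
  proof (intro conjI omega_unique)
    show "commutator A (x \<oplus> y) z = (W x z \<oplus>\<^bsub>F\<^esub> W y z) \<odot> \<one>"
      using x y z omega alg_one_closed
      by (simp add: smult_l_distr flip: omega(2))
        (simp add: commutator_def alg_l_distr alg_r_distr alg_mult_closed M.minus_eq M.minus_add
          M.a_ac)
    show "commutator A z (x \<oplus> y) = (W z x \<oplus>\<^bsub>F\<^esub> W z y) \<odot> \<one>"
      using x y z omega alg_one_closed
      by (simp add: smult_l_distr flip: omega(2))
        (simp add: commutator_def alg_l_distr alg_r_distr alg_mult_closed M.minus_eq M.minus_add
          M.a_ac)
  qed (use x y z omega in auto)
  moreover have "W (c \<odot> x) y = c \<otimes>\<^bsub>F\<^esub> W x y \<and> W x (c \<odot> y) = c \<otimes>\<^bsub>F\<^esub> W x y"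
    if c: "c \<in> carrier F" and x: "x \<in> carrier A" and y: "y \<in> carrier A" for c x y
  proof (intro conjI omega_unique)
    show "commutator A (c \<odot> x) y = (c \<otimes>\<^bsub>F\<^esub> W x y) \<odot> \<one>"
      using c x y omega alg_one_closed
      by (simp add: smult_assoc1 flip: omega(2))
        (simp add: commutator_def alg_smult_l alg_smult_r alg_mult_closed M.minus_eq
          smult_r_distr smult_r_minus)
    show "commutator A x (c \<odot> y) = (c \<otimes>\<^bsub>F\<^esub> W x y) \<odot> \<one>"
      using c x y omega alg_one_closed
      by (simp add: smult_assoc1 flip: omega(2))
        (simp add: commutator_def alg_smult_l alg_smult_r alg_mult_closed M.minus_eq
          smult_r_distr smult_r_minus)
  qed (use c x y omega in auto)
  ultimately show ?thesis unfolding bilinear_form_def using omega(1) by simp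
qed

lemma omega_one:
  assumes "x \<in> carrier A"
  shows "W x \<one> = \<zero>\<^bsub>F\<^esub>" "W \<one> x = \<zero>\<^bsub>F\<^esub>"
  using assms alg_one_closed
  by (auto intro!: omega_unique simp: commutator_def alg_l_one alg_r_one M.minus_eq M.r_neg)

lemma square_eq:
  assumes x: "x \<in> carrier A"
  shows "x \<otimes> x = P x \<one> \<odot> x \<ominus> q x \<odot> \<one>"
proof -
  have c: "x \<otimes> x \<in> carrier A" "P x \<one> \<odot> x \<in> carrier A" "q x \<odot> \<one> \<in> carrier A"
    using x alg_one_closed by (auto simp: alg_mult_closed polar_closed norm_closed)
  have "x \<otimes> x \<oplus> \<ominus> (P x \<one> \<odot> x \<ominus> q x \<odot> \<one>) = \<zero>"
    using norm_equation[OF x] c by (simp add: M.minus_eq M.minus_add M.a_assoc)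
  then have "\<ominus> (\<ominus> (P x \<one> \<odot> x \<ominus> q x \<odot> \<one>)) = x \<otimes> x"
    using c by (intro M.minus_equality) auto
  then show ?thesis using c by simp
qed

text \<open>
  The norm equation of \<open>x + y\<close> minus those of \<open>x\<close> and \<open>y\<close>. The squares are kept on both sides
  and cancelled at the end, so that only an identity without cancellation has to be normalized.
\<close>

lemma linearized_norm_equation:
  assumes x: "x \<in> carrier A" and y: "y \<in> carrier A"
  shows "x \<otimes> y \<oplus> y \<otimes> x = (P x \<one> \<odot> y \<oplus> P y \<one> \<odot> x) \<ominus> P x y \<odot> \<one>"
proof -
  let ?K = "(x \<otimes> x) \<oplus> (y \<otimes> y)"
  have F: "P x \<one> \<in> carrier F" "P y \<one> \<in> carrier F" "P x y \<in> carrier F"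
    "q x \<in> carrier F" "q y \<in> carrier F" "q (x \<oplus> y) \<in> carrier F"
    using x y alg_one_closed polar_closed norm_closed by auto
  have qxy: "q (x \<oplus> y) = (q x \<oplus>\<^bsub>F\<^esub> q y) \<oplus>\<^bsub>F\<^esub> P x y"
    unfolding polar_form_def using F by algebra
  have Pxy: "P (x \<oplus> y) \<one> = P x \<one> \<oplus>\<^bsub>F\<^esub> P y \<one>"
    using polar_bilinear x y alg_one_closed unfolding bilinear_form_def by blast
  have "?K \<oplus> (x \<otimes> y \<oplus> y \<otimes> x) = (x \<oplus> y) \<otimes> (x \<oplus> y)"
    using x y by (simp add: alg_l_distr alg_r_distr alg_mult_closed M.a_ac)
  also have "\<dots> = (P x \<one> \<oplus>\<^bsub>F\<^esub> P y \<one>) \<odot> (x \<oplus> y) \<ominus> ((q x \<oplus>\<^bsub>F\<^esub> q y) \<oplus>\<^bsub>F\<^esub> P x y) \<odot> \<one>"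
    using square_eq[of "x \<oplus> y"] x y by (simp add: Pxy qxy)
  also have "\<dots> = ?K \<oplus> ((P x \<one> \<odot> y \<oplus> P y \<one> \<odot> x) \<ominus> P x y \<odot> \<one>)"
    unfolding square_eq[OF x] square_eq[OF y]
    using F x y alg_one_closed
    by (simp add: smult_l_distr smult_r_distr M.minus_eq M.minus_add M.a_ac)
  finally show ?thesis
    using x y F alg_one_closed by (simp add: alg_mult_closed)
qed

text \<open>
  The sum of the linearized norm equation and the commutator relation is twice the product
  formula; this is where the characteristic enters. The value \<open>q(1,1) = 2\<close>, and with it \<open>B(1,1) = 1\<close>, is
  read off from the linearized norm equation at \<open>x = y = 1\<close>.
\<close>

lemma form_algebra_vidinli:
  assumes two: "\<one>\<^bsub>F\<^esub> \<oplus>\<^bsub>F\<^esub> \<one>\<^bsub>F\<^esub> \<noteq> \<zero>\<^bsub>F\<^esub>"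
  shows "form_algebra F A (vidinli_form F A q)"
proof (intro form_algebra.intro form_algebra_axioms.intro nonassoc_algebra_axioms)
  let ?two = "\<one>\<^bsub>F\<^esub> \<oplus>\<^bsub>F\<^esub> \<one>\<^bsub>F\<^esub>" and ?B = "vidinli_form F A q"
  define h where "h = inv\<^bsub>F\<^esub> ?two"
  have h: "h \<in> carrier F" "h \<otimes>\<^bsub>F\<^esub> ?two = \<one>\<^bsub>F\<^esub>"
    using two F.field_Units by (auto simp: h_def)
  have B: "?B x y = h \<otimes>\<^bsub>F\<^esub> (P x y \<ominus>\<^bsub>F\<^esub> W x y)" for x y
    by (simp add: vidinli_form_def h_def)
  have B_one: "?B x \<one> = h \<otimes>\<^bsub>F\<^esub> P x \<one>" "?B \<one> x = h \<otimes>\<^bsub>F\<^esub> P x \<one>" if "x \<in> carrier A" for x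
    unfolding B omega_one[OF that] polar_sym[OF alg_one_closed that]
    using polar_closed[OF that alg_one_closed] by (simp_all add: R.minus_eq)
  show "\<one> \<in> carrier A" by (rule alg_one_closed)
  show "?two \<noteq> \<zero>\<^bsub>F\<^esub>" by (rule two)
  show "?B \<one> x = ?B x \<one>" if "x \<in> carrier A" for x
    using B_one[OF that] by simp
  show "bilinear_form F A ?B"
  proof -
    have comb_add: "h \<otimes>\<^bsub>F\<^esub> ((p \<oplus>\<^bsub>F\<^esub> p') \<ominus>\<^bsub>F\<^esub> (w \<oplus>\<^bsub>F\<^esub> w'))
        = h \<otimes>\<^bsub>F\<^esub> (p \<ominus>\<^bsub>F\<^esub> w) \<oplus>\<^bsub>F\<^esub> h \<otimes>\<^bsub>F\<^esub> (p' \<ominus>\<^bsub>F\<^esub> w')"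
      if "p \<in> carrier F" "p' \<in> carrier F" "w \<in> carrier F" "w' \<in> carrier F" for p p' w w'
      using that h(1) by algebra
    have comb_smult: "h \<otimes>\<^bsub>F\<^esub> (c \<otimes>\<^bsub>F\<^esub> p \<ominus>\<^bsub>F\<^esub> c \<otimes>\<^bsub>F\<^esub> w) = c \<otimes>\<^bsub>F\<^esub> (h \<otimes>\<^bsub>F\<^esub> (p \<ominus>\<^bsub>F\<^esub> w))"
      if "c \<in> carrier F" "p \<in> carrier F" "w \<in> carrier F" for c p w
      using that h(1) by algebra
    have "?B (x \<oplus> y) z = ?B x z \<oplus>\<^bsub>F\<^esub> ?B y z \<and> ?B z (x \<oplus> y) = ?B z x \<oplus>\<^bsub>F\<^esub> ?B z y"
      if "x \<in> carrier A" "y \<in> carrier A" "z \<in> carrier A" for x y z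
    proof -
      have "P (x \<oplus> y) z = P x z \<oplus>\<^bsub>F\<^esub> P y z" "P z (x \<oplus> y) = P z x \<oplus>\<^bsub>F\<^esub> P z y"
        "W (x \<oplus> y) z = W x z \<oplus>\<^bsub>F\<^esub> W y z" "W z (x \<oplus> y) = W z x \<oplus>\<^bsub>F\<^esub> W z y"
        using polar_bilinear omega_bilinear that unfolding bilinear_form_def by blast+
      then show ?thesis
        unfolding B using that by (simp add: comb_add polar_closed omega(1))
    qed
    moreover have "?B (c \<odot> x) y = c \<otimes>\<^bsub>F\<^esub> ?B x y \<and> ?B x (c \<odot> y) = c \<otimes>\<^bsub>F\<^esub> ?B x y"
      if "c \<in> carrier F" "x \<in> carrier A" "y \<in> carrier A" for c x y
    proof -
      have "P (c \<odot> x) y = c \<otimes>\<^bsub>F\<^esub> P x y" "P x (c \<odot> y) = c \<otimes>\<^bsub>F\<^esub> P x y"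
        "W (c \<odot> x) y = c \<otimes>\<^bsub>F\<^esub> W x y" "W x (c \<odot> y) = c \<otimes>\<^bsub>F\<^esub> W x y"
        using polar_bilinear omega_bilinear that unfolding bilinear_form_def by blast+
      then show ?thesis
        unfolding B using that by (simp add: comb_smult polar_closed omega(1))
    qed
    moreover have "?B x y \<in> carrier F" if "x \<in> carrier A" "y \<in> carrier A" for x y
      unfolding B using that h(1) polar_closed omega(1) by simp
    ultimately show ?thesis unfolding bilinear_form_def by simp
  qed
  have "P \<one> \<one> \<odot> \<one> = ?two \<odot> \<one>"
  proof -
    have p: "P \<one> \<one> \<odot> \<one> \<in> carrier A" using polar_closed alg_one_closed by simp
    have "?two \<odot> \<one> = \<one> \<otimes> \<one> \<oplus> \<one> \<otimes> \<one>"
      using alg_one_closed by (simp add: smult_l_distr alg_l_one)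
    also have "\<dots> = (P \<one> \<one> \<odot> \<one> \<oplus> P \<one> \<one> \<odot> \<one>) \<ominus> P \<one> \<one> \<odot> \<one>"
      by (rule linearized_norm_equation[OF alg_one_closed alg_one_closed])
    also have "\<dots> = P \<one> \<one> \<odot> \<one>"
      using p by (simp only: M.minus_eq M.a_assoc M.r_neg M.r_zero M.a_inv_closed)
    finally show ?thesis by simp
  qed
  then have "P \<one> \<one> = ?two"
    using scalar_inj polar_closed alg_one_closed by simp
  then show "?B \<one> \<one> = \<one>\<^bsub>F\<^esub>"
    using B_one(1)[OF alg_one_closed] h by simp
  show "x \<otimes> y = (?B x \<one> \<odot> y \<oplus> ?B y \<one> \<odot> x) \<ominus> ?B x y \<odot> \<one>"
    if x: "x \<in> carrier A" and y: "y \<in> carrier A" for x y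
  proof -
    have F: "P x \<one> \<in> carrier F" "P y \<one> \<in> carrier F" "P x y \<in> carrier F" "W x y \<in> carrier F"
      using x y alg_one_closed polar_closed omega by auto
    have m: "x \<otimes> y \<in> carrier A" "y \<otimes> x \<in> carrier A" using x y alg_mult_closed by auto
    have "x \<otimes> y = h \<odot> (?two \<odot> (x \<otimes> y))"
      using h m by (simp flip: smult_assoc1)
    also have "?two \<odot> (x \<otimes> y) = (x \<otimes> y \<oplus> y \<otimes> x) \<oplus> commutator A x y"
      using m by (simp add: smult_l_distr commutator_def M.minus_eq M.a_ac M.r_neg)
    also have "\<dots> = ((P x \<one> \<odot> y \<oplus> P y \<one> \<odot> x) \<ominus> P x y \<odot> \<one>) \<oplus> W x y \<odot> \<one>"
      using linearized_norm_equation[OF x y] omega(2)[OF x y] by simp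
    also have "h \<odot> \<dots> = (?B x \<one> \<odot> y \<oplus> ?B y \<one> \<odot> x) \<ominus> ?B x y \<odot> \<one>"
      unfolding B_one(1)[OF x] B_one(1)[OF y] unfolding B
      using F h(1) x y alg_one_closed
      by (simp add: smult_assoc1 smult_r_distr smult_l_distr smult_r_minus smult_l_minus
          M.minus_eq R.minus_eq M.minus_add M.a_assoc)
    finally show ?thesis .
  qed
qed

end

theorem theorem3p4:
  fixes F :: "('f, 'm) ring_scheme"
    and A :: "('f, 'a, 'n) module_scheme"
    and q :: "'a \<Rightarrow> 'f"
    and radB :: "'a set"
  assumes vidinli: "vidinli_algebra F A q"
    and char_not_2: "\<one>\<^bsub>F\<^esub> \<oplus>\<^bsub>F\<^esub> \<one>\<^bsub>F\<^esub> \<noteq> \<zero>\<^bsub>F\<^esub>"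
    and radB: "radB = form_radical F A (vidinli_form F A q)"
  shows "(alg_ideal F A radB \<and> span_prod F A radB radB = {\<zero>\<^bsub>A\<^esub>})
    \<and> ((solvable_ideal F A radB \<and> (\<forall>I. solvable_ideal F A I \<longrightarrow> I \<subseteq> radB))
        \<and> (simple_algebra F (quot_algebra A radB)
            \<or> alg_isomorphic F (quot_algebra A radB) (square_algebra F)))
    \<and> (\<exists>S. unital_subalgebra F A S \<and> S <+>\<^bsub>A\<^esub> radB = carrier A
            \<and> S \<inter> radB = {\<zero>\<^bsub>A\<^esub>})"
proof -
  interpret form_algebra F A "vidinli_form F A q"
    by (rule vidinli_algebra.form_algebra_vidinli[OF vidinli char_not_2])
  obtain S where "unital_subalgebra F A S" "S <+>\<^bsub>A\<^esub> radB = carrier A" "S \<inter> radB = {\<zero>\<^bsub>A\<^esub>}"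
    unfolding radB by (rule rad_complement)
  then show ?thesis
    using alg_ideal_rad rad_square_zero solvable_rad solvable_in_rad quot_simple_or_square
    unfolding radB by blast
qed

end
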